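(* Let $M$ be a hypersurface in a Riemannian space of constant curvature $N^{n+1}(c)$, $n \geq 3$, having at every point $x\in\mathcal{U}_{H}\subset M$ three distinct principal curvatures $\lambda_{0}$, $\lambda_{1}$ and $\lambda_{2}$, with multiplicities $n_{0}$, $n_{1}$ and $n_{2}$, respectively, where $n_0+n_1+n_2=n$. Let $$\kappa_{i} = \mathrm{tr}(H)\,\lambda_{i} - \lambda_{i}^{2} + (n-1)c,\qquad i=0,1,2,$$ be the corresponding eigenvalues of the Ricci operator $\mathcal{S}$ of $M$ on $\mathcal{U}_H$. Then the function $$\tau = \rho + (\phi - \mathrm{tr}(H))\bigl(\psi + \mathrm{tr}(H)(\phi - \mathrm{tr}(H))\bigr),$$ where $\phi=\lambda_0+\lambda_1+\lambda_2$, $\psi=-\lambda_0(\lambda_1+\lambda_2)-\lambda_1\lambda_2$ and $\rho=\lambda_0\lambda_1\lambda_2$ (so that $H^{3}=\phi H^{2}+\psi H+\rho g$ on $\mathcal{U}_H$), satisfies on $\mathcal{U}_{H}$ $$\tau = \frac{(\kappa_{0}-\kappa_{1})(\kappa_{0}-\kappa_{2})(\kappa_{1}-\kappa_{2})}{(\lambda_{0}-\lambda_{1})(\lambda_{0}-\lambda_{2})(\lambda_{1}-\lambda_{2})}.$$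
   Context: All manifolds are connected, paracompact and of class $C^\infty$. $N^{n+1}(c)$ is an $(n+1)$-dimensional Riemannian space of constant curvature $c$; $M$ is isometrically immersed with induced metric $g$, shape operator $\mathcal{A}$, and second fundamental tensor $H(X,Y)=g(\mathcal{A}X,Y)$; principal curvatures are the eigenvalues of $\mathcal{A}$ and $\mathrm{tr}(H)=\mathrm{tr}\,\mathcal{A}$. $H^2(X,Y)=H(\mathcal{A}X,Y)$, $H^3(X,Y)=H^2(\mathcal{A}X,Y)$. $\mathcal{U}_H$ is the set of all points of $M$ at which $H^2$ is not a linear combination of $H$ and $g$. The Ricci operator is defined by $g(\mathcal{S}X,Y)=S(X,Y)$, with $S$ the Ricci tensor of $M$ (sign convention: $S$ is positive on round spheres). *)

theory Defs
  imports "HOL-Analysis.Analysis"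
begin

text \<open>
  Smooth functions on an open subset of a Euclidean space: all iterated directional
  derivatives exist and are continuous.
\<close>

primrec Ck_on :: "nat \<Rightarrow> ('a::euclidean_space \<Rightarrow> 'b::real_normed_vector) \<Rightarrow> 'a set \<Rightarrow> bool" where
  "Ck_on 0 h S \<longleftrightarrow> continuous_on S h"
| "Ck_on (Suc k) h S \<longleftrightarrow>
     (\<forall>x\<in>S. h differentiable (at x)) \<and> (\<forall>v. Ck_on k (\<lambda>x. frechet_derivative h (at x) v) S)"

definition smooth_on :: "('a::euclidean_space \<Rightarrow> 'b::real_normed_vector) \<Rightarrow> 'a set \<Rightarrow> bool" where
  "smooth_on h S \<longleftrightarrow> (\<forall>k. Ck_on k h S)"


text \<open>
  Linear algebra in a finite-dimensional space. The inner product of the ambient class only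
  serves to compute traces (which do not depend on it); the scalar products of the
  geometry are separate arguments \<open>B\<close>.
\<close>

definition is_inner_product :: "('e::euclidean_space \<Rightarrow> 'e \<Rightarrow> real) \<Rightarrow> bool" where
  "is_inner_product B \<longleftrightarrow>
     (\<forall>u. linear (B u)) \<and> (\<forall>u v. B u v = B v u) \<and> (\<forall>u. u \<noteq> 0 \<longrightarrow> B u u > 0)"

definition lin_trace :: "('e::euclidean_space \<Rightarrow> 'e) \<Rightarrow> real" where
  "lin_trace L = (\<Sum>b\<in>Basis. L b \<bullet> b)"

text \<open>The operator \<open>L\<close> with \<open>B (L v) w = T v w\<close>, for a bilinear form \<open>T\<close> and a scalar product \<open>B\<close>.\<close>

definition op_of_form ::
    "('e::euclidean_space \<Rightarrow> 'e \<Rightarrow> real) \<Rightarrow> ('e \<Rightarrow> 'e \<Rightarrow> real) \<Rightarrow> 'e \<Rightarrow> 'e" where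
  "op_of_form B T v = (THE z. \<forall>w. B z w = T v w)"

definition eigenspace :: "('e::euclidean_space \<Rightarrow> 'e) \<Rightarrow> real \<Rightarrow> 'e set" where
  "eigenspace L a = {v. L v = a *\<^sub>R v}"

definition eigenvalues :: "('e::euclidean_space \<Rightarrow> 'e) \<Rightarrow> real set" where
  "eigenvalues L = {a. \<exists>v. v \<noteq> 0 \<and> L v = a *\<^sub>R v}"


text \<open>
  Manifolds. A chart \<open>(U, h)\<close> consists of a domain and a coordinate map into the model
  space \<open>'e\<close>, whose dimension is that of the manifold.
\<close>

definition paracompact_space :: "'m topology \<Rightarrow> bool" where
  "paracompact_space X \<longleftrightarrow>
     (\<forall>\<U>. (\<forall>U\<in>\<U>. openin X U) \<and> \<Union>\<U> = topspace X \<longrightarrow>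
        (\<exists>\<V>. (\<forall>V\<in>\<V>. openin X V \<and> (\<exists>U\<in>\<U>. V \<subseteq> U)) \<and> \<Union>\<V> = topspace X \<and>
             locally_finite_in X \<V>))"

type_synonym ('m, 'e) chart = "'m set \<times> ('m \<Rightarrow> 'e)"

definition chart_image :: "('m, 'e) chart \<Rightarrow> 'e set" where
  "chart_image c = snd c ` fst c"

definition chart_inv :: "('m, 'e) chart \<Rightarrow> 'e \<Rightarrow> 'm" where
  "chart_inv c = inv_into (fst c) (snd c)"

definition is_chart :: "'m topology \<Rightarrow> ('m, 'e::euclidean_space) chart \<Rightarrow> bool" where
  "is_chart X c \<longleftrightarrow> openin X (fst c) \<and> open (chart_image c) \<and>
     homeomorphic_map (subtopology X (fst c)) (top_of_set (chart_image c)) (snd c)"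

definition smooth_atlas :: "'m topology \<Rightarrow> ('m, 'e::euclidean_space) chart set \<Rightarrow> bool" where
  "smooth_atlas X \<A> \<longleftrightarrow>
     (\<forall>c\<in>\<A>. is_chart X c) \<and> (\<Union>c\<in>\<A>. fst c) = topspace X \<and>
     (\<forall>c\<in>\<A>. \<forall>d\<in>\<A>. smooth_on (snd d \<circ> chart_inv c) (snd c ` (fst c \<inter> fst d)))"

text \<open>
  The tangent space at \<open>p\<close> is the model space \<open>'e\<close>, identified with the geometric tangent
  space by the differential of a chart \<open>chart_at M p\<close> around \<open>p\<close> that is chosen once and for
  all. Accordingly \<open>metric M p\<close> is a bilinear form on \<open>'e\<close>, and so are all tensors at \<open>p\<close>
  below; quantities such as eigenvalues and traces do not depend on the choice.
\<close>

record ('m, 'e) riem_space =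
  top_of :: "'m topology"
  atlas :: "('m, 'e) chart set"
  metric :: "'m \<Rightarrow> 'e \<Rightarrow> 'e \<Rightarrow> real"

definition points :: "('m, 'e) riem_space \<Rightarrow> 'm set" where
  "points M = topspace (top_of M)"

definition chart_at :: "('m, 'e) riem_space \<Rightarrow> 'm \<Rightarrow> ('m, 'e) chart" where
  "chart_at M p = (SOME c. c \<in> atlas M \<and> p \<in> fst c)"

definition coord_at :: "('m, 'e) riem_space \<Rightarrow> 'm \<Rightarrow> 'e" where
  "coord_at M p = snd (chart_at M p) p"

text \<open>
  For a chart \<open>c\<close> around \<open>p\<close>: the linear map sending the coordinates, with respect to \<open>c\<close>, of
  a tangent vector at \<open>p\<close> to this vector.
\<close>

definition to_tangent ::
    "('m, 'e::euclidean_space) riem_space \<Rightarrow> ('m, 'e) chart \<Rightarrow> 'm \<Rightarrow> 'e \<Rightarrow> 'e" where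
  "to_tangent M c p = frechet_derivative (snd (chart_at M p) \<circ> chart_inv c) (at (snd c p))"

text \<open>The metric in the chart \<open>c\<close>, a field of bilinear forms on \<open>chart_image c\<close>.\<close>

definition metric_in ::
    "('m, 'e::euclidean_space) riem_space \<Rightarrow> ('m, 'e) chart \<Rightarrow> 'e \<Rightarrow> 'e \<Rightarrow> 'e \<Rightarrow> real" where
  "metric_in M c x u v =
     (let p = chart_inv c x in metric M p (to_tangent M c p u) (to_tangent M c p v))"

definition riemannian_manifold :: "('m, 'e::euclidean_space) riem_space \<Rightarrow> bool" where
  "riemannian_manifold M \<longleftrightarrow>
     connected_space (top_of M) \<and> Hausdorff_space (top_of M) \<and> paracompact_space (top_of M) \<and>
     smooth_atlas (top_of M) (atlas M) \<and>
     (\<forall>p\<in>points M. is_inner_product (metric M p)) \<and>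
     (\<forall>c\<in>atlas M. \<forall>u v. smooth_on (\<lambda>x. metric_in M c x u v) (chart_image c))"


text \<open>
  Levi-Civita connection and curvature of a metric \<open>G\<close> on an open subset of \<open>'e\<close>. For constant
  vector fields \<open>u\<close>, \<open>v\<close> the vector \<open>christoffel G x u v\<close> is the covariant derivative of \<open>v\<close> in
  direction \<open>u\<close> at \<open>x\<close>, and it is characterised by the Koszul formula.
  The curvature convention is \<open>R(u,v)w = D_u D_v w - D_v D_u w - D_[u,v] w\<close>.
\<close>

definition christoffel ::
    "('e::euclidean_space \<Rightarrow> 'e \<Rightarrow> 'e \<Rightarrow> real) \<Rightarrow> 'e \<Rightarrow> 'e \<Rightarrow> 'e \<Rightarrow> 'e" where
  "christoffel G x u v = (THE z. \<forall>w. 2 * G x z w =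
     frechet_derivative (\<lambda>y. G y v w) (at x) u
     + frechet_derivative (\<lambda>y. G y u w) (at x) v
     - frechet_derivative (\<lambda>y. G y u v) (at x) w)"

definition curvature_in ::
    "('e::euclidean_space \<Rightarrow> 'e \<Rightarrow> 'e \<Rightarrow> real) \<Rightarrow> 'e \<Rightarrow> 'e \<Rightarrow> 'e \<Rightarrow> 'e \<Rightarrow> 'e" where
  "curvature_in G x u v w =
     frechet_derivative (\<lambda>y. christoffel G y v w) (at x) u
     - frechet_derivative (\<lambda>y. christoffel G y u w) (at x) v
     + christoffel G x u (christoffel G x v w) - christoffel G x v (christoffel G x u w)"

definition curvature ::
    "('m, 'e::euclidean_space) riem_space \<Rightarrow> 'm \<Rightarrow> 'e \<Rightarrow> 'e \<Rightarrow> 'e \<Rightarrow> 'e" where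
  "curvature M p = curvature_in (metric_in M (chart_at M p)) (coord_at M p)"

definition sectional_curvature ::
    "('m, 'e::euclidean_space) riem_space \<Rightarrow> 'm \<Rightarrow> 'e \<Rightarrow> 'e \<Rightarrow> real" where
  "sectional_curvature M p u v = metric M p (curvature M p u v v) u /
     (metric M p u u * metric M p v v - (metric M p u v)\<^sup>2)"

definition constant_curvature :: "('m, 'e::euclidean_space) riem_space \<Rightarrow> real \<Rightarrow> bool" where
  "constant_curvature M c \<longleftrightarrow> (\<forall>p\<in>points M. \<forall>u v.
     u \<noteq> v \<and> independent {u, v} \<longrightarrow> sectional_curvature M p u v = c)"

text \<open>With these conventions the Ricci tensor of a round sphere is positive.\<close>

definition ricci :: "('m, 'e::euclidean_space) riem_space \<Rightarrow> 'm \<Rightarrow> 'e \<Rightarrow> 'e \<Rightarrow> real" where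
  "ricci M p v w = lin_trace (\<lambda>u. curvature M p u v w)"

definition ricci_op :: "('m, 'e::euclidean_space) riem_space \<Rightarrow> 'm \<Rightarrow> 'e \<Rightarrow> 'e" where
  "ricci_op M p = op_of_form (metric M p) (ricci M p)"


text \<open>Maps between manifolds and isometric immersions.\<close>

definition smooth_map :: "('m, 'e::euclidean_space) riem_space \<Rightarrow>
    ('k, 'f::euclidean_space) riem_space \<Rightarrow> ('m \<Rightarrow> 'k) \<Rightarrow> bool" where
  "smooth_map M N f \<longleftrightarrow> continuous_map (top_of M) (top_of N) f \<and>
     (\<forall>c\<in>atlas M. \<forall>d\<in>atlas N.
        smooth_on (snd d \<circ> f \<circ> chart_inv c) (snd c ` (fst c \<inter> f -` fst d)))"

definition local_rep :: "('m, 'e::euclidean_space) riem_space \<Rightarrow>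
    ('k, 'f::euclidean_space) riem_space \<Rightarrow> ('m \<Rightarrow> 'k) \<Rightarrow> 'm \<Rightarrow> 'e \<Rightarrow> 'f" where
  "local_rep M N f p = snd (chart_at N (f p)) \<circ> f \<circ> chart_inv (chart_at M p)"

definition differential :: "('m, 'e::euclidean_space) riem_space \<Rightarrow>
    ('k, 'f::euclidean_space) riem_space \<Rightarrow> ('m \<Rightarrow> 'k) \<Rightarrow> 'm \<Rightarrow> 'e \<Rightarrow> 'f" where
  "differential M N f p = frechet_derivative (local_rep M N f p) (at (coord_at M p))"

definition isometric_immersion :: "('m, 'e::euclidean_space) riem_space \<Rightarrow>
    ('k, 'f::euclidean_space) riem_space \<Rightarrow> ('m \<Rightarrow> 'k) \<Rightarrow> bool" where
  "isometric_immersion M N f \<longleftrightarrow> smooth_map M N f \<and>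
     (\<forall>p\<in>points M. inj (differential M N f p)) \<and>
     (\<forall>p\<in>points M. \<forall>u v. metric M p u v =
        metric N (f p) (differential M N f p u) (differential M N f p v))"


text \<open>
  The hypersurface \<open>f : M \<rightarrow> N\<close>. A unit normal is chosen at every point, without any
  continuity requirement: everything below depends on \<open>\<xi>\<close> only through its value at the point,
  so that this covers local as well as global unit normal fields.
\<close>

definition unit_normal :: "('m, 'e::euclidean_space) riem_space \<Rightarrow>
    ('k, 'f::euclidean_space) riem_space \<Rightarrow> ('m \<Rightarrow> 'k) \<Rightarrow> ('m \<Rightarrow> 'f) \<Rightarrow> bool" where
  "unit_normal M N f \<xi> \<longleftrightarrow> (\<forall>p\<in>points M. metric N (f p) (\<xi> p) (\<xi> p) = 1 \<and>
     (\<forall>u. metric N (f p) (\<xi> p) (differential M N f p u) = 0))"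

text \<open>
  The covariant derivative in \<open>N\<close>, in direction \<open>u\<close> at \<open>p\<close>, of the vector field \<open>df(V)\<close> along \<open>f\<close>,
  where \<open>V\<close> is the vector field with constant coordinates \<open>v\<close> in the chart around \<open>p\<close>.
\<close>

definition ambient_deriv :: "('m, 'e::euclidean_space) riem_space \<Rightarrow>
    ('k, 'f::euclidean_space) riem_space \<Rightarrow> ('m \<Rightarrow> 'k) \<Rightarrow> 'm \<Rightarrow> 'e \<Rightarrow> 'e \<Rightarrow> 'f" where
  "ambient_deriv M N f p u v =
     (let F = local_rep M N f p
      in frechet_derivative (\<lambda>x. frechet_derivative F (at x) v) (at (coord_at M p)) u
         + christoffel (metric_in N (chart_at N (f p))) (coord_at N (f p))
             (differential M N f p u) (differential M N f p v))"

text \<open>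
  Gauss formula: \<open>H(u,v) \<xi>\<close> is the normal component of the ambient covariant derivative.
\<close>

definition second_form :: "('m, 'e::euclidean_space) riem_space \<Rightarrow>
    ('k, 'f::euclidean_space) riem_space \<Rightarrow> ('m \<Rightarrow> 'k) \<Rightarrow> ('m \<Rightarrow> 'f) \<Rightarrow> 'm \<Rightarrow> 'e \<Rightarrow> 'e \<Rightarrow> real" where
  "second_form M N f \<xi> p u v = metric N (f p) (ambient_deriv M N f p u v) (\<xi> p)"

definition shape_op :: "('m, 'e::euclidean_space) riem_space \<Rightarrow>
    ('k, 'f::euclidean_space) riem_space \<Rightarrow> ('m \<Rightarrow> 'k) \<Rightarrow> ('m \<Rightarrow> 'f) \<Rightarrow> 'm \<Rightarrow> 'e \<Rightarrow> 'e" where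
  "shape_op M N f \<xi> p = op_of_form (metric M p) (second_form M N f \<xi> p)"

definition second_form2 :: "('m, 'e::euclidean_space) riem_space \<Rightarrow>
    ('k, 'f::euclidean_space) riem_space \<Rightarrow> ('m \<Rightarrow> 'k) \<Rightarrow> ('m \<Rightarrow> 'f) \<Rightarrow> 'm \<Rightarrow> 'e \<Rightarrow> 'e \<Rightarrow> real" where
  "second_form2 M N f \<xi> p u v = second_form M N f \<xi> p (shape_op M N f \<xi> p u) v"

definition second_form3 :: "('m, 'e::euclidean_space) riem_space \<Rightarrow>
    ('k, 'f::euclidean_space) riem_space \<Rightarrow> ('m \<Rightarrow> 'k) \<Rightarrow> ('m \<Rightarrow> 'f) \<Rightarrow> 'm \<Rightarrow> 'e \<Rightarrow> 'e \<Rightarrow> real" where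
  "second_form3 M N f \<xi> p u v = second_form2 M N f \<xi> p (shape_op M N f \<xi> p u) v"

definition trH :: "('m, 'e::euclidean_space) riem_space \<Rightarrow>
    ('k, 'f::euclidean_space) riem_space \<Rightarrow> ('m \<Rightarrow> 'k) \<Rightarrow> ('m \<Rightarrow> 'f) \<Rightarrow> 'm \<Rightarrow> real" where
  "trH M N f \<xi> p = lin_trace (shape_op M N f \<xi> p)"

definition U_H :: "('m, 'e::euclidean_space) riem_space \<Rightarrow>
    ('k, 'f::euclidean_space) riem_space \<Rightarrow> ('m \<Rightarrow> 'k) \<Rightarrow> ('m \<Rightarrow> 'f) \<Rightarrow> 'm set" where
  "U_H M N f \<xi> = {p \<in> points M. \<not> (\<exists>a b. \<forall>u v. second_form2 M N f \<xi> p u v =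
     a * second_form M N f \<xi> p u v + b * metric M p u v)}"

end

theory Submission
  imports Defs
begin

text \<open>
  Fix a point \<open>p\<close> of the hypersurface and write \<open>g\<close>, \<open>H\<close>, \<open>A\<close> for the metric, the second
  fundamental form and the shape operator there. Everything follows from the Gauss equation
  for an ambient space of constant curvature \<open>c\<close>:
  \<open>g(R(u,v)w, z) = c (g(v,w) g(u,z) - g(u,w) g(v,z)) + H(v,w) H(u,z) - H(u,w) H(v,z)\<close>.
  It exhibits \<open>R(u,v)w\<close>, as a function of \<open>u\<close>, as a combination of \<open>u\<close>, of \<open>A u\<close> and of maps of
  rank one, so that its trace can be read off: the Ricci operator is
  \<open>S v = (n - 1) c v + tr(A) A v - A (A v)\<close>, a polynomial in \<open>A\<close>. An eigenvector of \<open>A\<close> with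
  eigenvalue \<open>\<mu>\<close> is therefore one of \<open>S\<close> with eigenvalue \<open>tr(A) \<mu> - \<mu>\<^sup>2 + (n - 1) c\<close>. As the
  multiplicities add up to \<open>n\<close>, the three eigenspaces of \<open>A\<close> span the tangent space; so \<open>S\<close> has
  no further eigenvalues, and \<open>A\<close> is annihilated by the polynomial with roots \<open>\<mu>\<^sub>0\<close>, \<open>\<mu>\<^sub>1\<close>, \<open>\<mu>\<^sub>2\<close>,
  which is the cubic relation for \<open>H\<close>. Finally \<open>\<kappa>\<^sub>i - \<kappa>\<^sub>j = (\<mu>\<^sub>i - \<mu>\<^sub>j) (tr(A) - \<mu>\<^sub>i - \<mu>\<^sub>j)\<close>, and
  expanding the product of the three second factors gives \<open>\<tau>\<close>.

  The bulk of the work is the Gauss equation, which is proved in charts. The central lemma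
  \<open>curvature_pullback\<close> concerns an arbitrary smooth map \<open>F\<close> into an open set with a metric \<open>G\<close>.
  It commutes covariant derivatives of the fields \<open>dF(w)\<close> along \<open>F\<close> and expresses
  \<open>G(R(dF u, dF v) dF w, dF z)\<close> by the pulled-back metric and the covariant derivatives
  \<open>hess u v\<close> of \<open>dF v\<close> in direction \<open>u\<close>. For \<open>F = id\<close> it yields the intrinsic curvature formula,
  hence also the algebraic symmetries of the curvature tensor; for the immersion it yields the
  ambient curvature. Since the pulled-back metric is the metric of the hypersurface, subtracting
  the two instances leaves precisely the Gauss equation (\<open>gauss_equation\<close>). The symmetries in
  turn show that constant sectional curvature determines the whole ambient curvature tensor
  (\<open>constant_sectional_curvature\<close>), and \<open>isometric_in_charts\<close> carries all this from charts to
  manifolds.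

  Two analytic facts are needed on the way: second derivatives commute
  (\<open>second_derivative_symmetric\<close>), and Christoffel symbols, which are defined only implicitly by
  the Koszul formula, depend differentiably on the point (\<open>riesz_differentiable\<close>).
\<close>

section \<open>Directional derivatives of smooth maps\<close>

abbreviation dderiv :: "('a::real_normed_vector \<Rightarrow> 'b::real_normed_vector) \<Rightarrow> 'a \<Rightarrow> 'a \<Rightarrow> 'b"
  where "dderiv h v x \<equiv> frechet_derivative h (at x) v"

lemma differentiable_has_dderiv:
  "h differentiable (at x) \<Longrightarrow> (h has_derivative (\<lambda>v. dderiv h v x)) (at x)"
  by (simp only: eta_contract_eq frechet_derivative_works)

lemma smooth_on_differentiable: "smooth_on h S \<Longrightarrow> x \<in> S \<Longrightarrow> h differentiable (at x)"
  unfolding smooth_on_def by (metis Ck_on.simps(2))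

lemma smooth_on_has_derivative:
  "smooth_on h S \<Longrightarrow> x \<in> S \<Longrightarrow> (h has_derivative (\<lambda>v. dderiv h v x)) (at x)"
  by (intro differentiable_has_dderiv smooth_on_differentiable)

lemma smooth_on_dderiv: "smooth_on h S \<Longrightarrow> smooth_on (\<lambda>x. dderiv h v x) S"
  unfolding smooth_on_def by (metis Ck_on.simps(2))

lemma smooth_on_continuous: "smooth_on h S \<Longrightarrow> continuous_on S h"
  unfolding smooth_on_def by (metis Ck_on.simps(1))

lemma dderiv_eqI: "(h has_derivative h') (at x) \<Longrightarrow> dderiv h v x = h' v"
  using frechet_derivative_at by metis

lemma dderiv_cong:
  assumes "open S" "x \<in> S" "\<And>y. y \<in> S \<Longrightarrow> h y = k y"
  shows "dderiv h v x = dderiv k v x"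
proof -
  have "(h has_derivative D) (at x) \<longleftrightarrow> (k has_derivative D) (at x)" for D
    using has_derivative_transform_within_open[OF _ assms(1,2)] assms(3) by metis
  then show ?thesis
    by (simp add: frechet_derivative_def)
qed

text \<open>
  Two applications of the mean value theorem, first in direction \<open>u\<close> and then in direction \<open>v\<close>.
  The left-hand side does not change when \<open>u\<close> and \<open>v\<close> are exchanged; comparing the two right-hand
  sides as \<open>e\<close> tends to \<open>0\<close> gives the symmetry of second derivatives.
\<close>

lemma second_difference:
  fixes f :: "'a::real_normed_vector \<Rightarrow> real"
  assumes f: "\<And>y. y \<in> ball x r \<Longrightarrow> (f has_derivative f' y) (at y)"
    and fu: "\<And>y. y \<in> ball x r \<Longrightarrow> ((\<lambda>y. f' y u) has_derivative f'' y) (at y)"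
    and e: "e > 0" "e * (norm u + norm v) < r"
  shows "\<exists>y. dist x y \<le> e * (norm u + norm v) \<and>
     f (x + e *\<^sub>R u + e *\<^sub>R v) - f (x + e *\<^sub>R u) - f (x + e *\<^sub>R v) + f x = e\<^sup>2 * f'' y v"
proof -
  have near: "dist x (x + s *\<^sub>R u + t *\<^sub>R v) \<le> e * (norm u + norm v)"
    if "0 \<le> s" "s \<le> e" "0 \<le> t" "t \<le> e" for s t
  proof -
    have "dist x (x + s *\<^sub>R u + t *\<^sub>R v) = norm (s *\<^sub>R u + t *\<^sub>R v)"
      by (metis add.assoc add_diff_cancel_left' dist_commute dist_norm)
    also have "\<dots> \<le> s * norm u + t * norm v"
      using norm_triangle_ineq[of "s *\<^sub>R u" "t *\<^sub>R v"] that by simp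
    also have "\<dots> \<le> e * norm u + e * norm v"
      using that by (intro add_mono mult_right_mono) auto
    finally show ?thesis by (simp add: algebra_simps)
  qed
  have inb: "x + s *\<^sub>R u + t *\<^sub>R v \<in> ball x r"
    if "0 \<le> s" "s \<le> e" "0 \<le> t" "t \<le> e" for s t
    using near[OF that] e by simp
  have D: "((\<lambda>s. h (a + s *\<^sub>R w)) has_derivative (\<lambda>k. k * h' w)) (at s within T)"
    if "(h has_derivative h') (at (a + s *\<^sub>R w))" for h :: "'a \<Rightarrow> real" and h' a s T w
  proof -
    have "((\<lambda>s. a + s *\<^sub>R w) has_derivative (\<lambda>k. k *\<^sub>R w)) (at s within T)"
      by (auto intro!: derivative_eq_intros)
    from has_derivative_compose[OF this that] show ?thesis
      using has_derivative_linear[OF that] by (simp add: linear_scale)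
  qed
  have "\<exists>s\<in>{0<..<e}. (f ((x + e *\<^sub>R v) + e *\<^sub>R u) - f (x + e *\<^sub>R u)) -
      (f ((x + e *\<^sub>R v) + 0 *\<^sub>R u) - f (x + 0 *\<^sub>R u)) =
      (e - 0) * f' ((x + e *\<^sub>R v) + s *\<^sub>R u) u - (e - 0) * f' (x + s *\<^sub>R u) u"
  proof (rule mvt_simple)
    fix s assume s: "0 \<le> s" "s \<le> e"
    have "x + e *\<^sub>R v + s *\<^sub>R u \<in> ball x r" "x + s *\<^sub>R u \<in> ball x r"
      using inb[of s e] inb[of s 0] s e by (simp_all add: add.commute add.left_commute)
    then show "((\<lambda>s. f ((x + e *\<^sub>R v) + s *\<^sub>R u) - f (x + s *\<^sub>R u)) has_derivative
      (\<lambda>h. h * f' ((x + e *\<^sub>R v) + s *\<^sub>R u) u - h * f' (x + s *\<^sub>R u) u))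
       (at s within {0..e})"
      by (intro has_derivative_diff D f)
  qed (use e in auto)
  then obtain s where s: "0 < s" "s < e" and
    eq1: "f (x + e *\<^sub>R u + e *\<^sub>R v) - f (x + e *\<^sub>R u) - f (x + e *\<^sub>R v) + f x
      = e * (f' (x + s *\<^sub>R u + e *\<^sub>R v) u - f' (x + s *\<^sub>R u) u)"
    by (auto simp: algebra_simps)
  have "\<exists>t\<in>{0<..<e}. f' ((x + s *\<^sub>R u) + e *\<^sub>R v) u - f' ((x + s *\<^sub>R u) + 0 *\<^sub>R v) u
      = (e - 0) * f'' ((x + s *\<^sub>R u) + t *\<^sub>R v) v"
    by (rule mvt_simple, use e in simp) (rule D, rule fu, rule inb, use s in auto)
  then obtain t where t: "0 < t" "t < e" and
    "f' (x + s *\<^sub>R u + e *\<^sub>R v) u - f' (x + s *\<^sub>R u) u = e * f'' (x + s *\<^sub>R u + t *\<^sub>R v) v"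
    by auto
  with eq1 near[of s t] s t show ?thesis
    by (intro exI[of _ "x + s *\<^sub>R u + t *\<^sub>R v"]) (simp add: power2_eq_square)
qed

lemma second_derivative_symmetric_real:
  fixes f :: "'a::real_normed_vector \<Rightarrow> real"
  assumes f: "\<And>y. y \<in> S \<Longrightarrow> (f has_derivative f' y) (at y)"
    and fu: "\<And>y. y \<in> S \<Longrightarrow> ((\<lambda>y. f' y u) has_derivative fu y) (at y)"
    and fv: "\<And>y. y \<in> S \<Longrightarrow> ((\<lambda>y. f' y v) has_derivative fv y) (at y)"
    and cont: "continuous_on S (\<lambda>y. fu y v)" "continuous_on S (\<lambda>y. fv y u)"
    and S: "open S" "x \<in> S"
  shows "fu x v = fv x u"
proof (rule ccontr)
  let ?a = "\<lambda>y. fu y v" and ?b = "\<lambda>y. fv y u"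
  assume ne: "?a x \<noteq> ?b x"
  \<comment> \<open>both mixed derivatives vary by less than half their distance near \<open>x\<close>, yet they agree at two nearby points\<close>
  define d where "d = \<bar>?a x - ?b x\<bar> / 2"
  have d: "d > 0" using ne by (simp add: d_def)
  have "continuous (at x) ?a" "continuous (at x) ?b"
    using S cont continuous_on_eq_continuous_at by blast+
  then obtain r1 r2 where r1: "r1 > 0" "\<And>y. dist y x < r1 \<Longrightarrow> dist (?a y) (?a x) < d"
    and r2: "r2 > 0" "\<And>y. dist y x < r2 \<Longrightarrow> dist (?b y) (?b x) < d"
    using d unfolding continuous_at_eps_delta by metis
  obtain r3 where r3: "r3 > 0" "ball x r3 \<subseteq> S"
    using S openE by blast
  define r where "r = min r1 (min r2 r3)"
  define e where "e = r / (norm u + norm v + 1)"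
  have r: "r > 0" "ball x r \<subseteq> S"
    using r1 r2 r3 by (auto simp: r_def)
  have n: "norm u + norm v + 1 > 0"
    by (smt (verit) norm_ge_zero)
  have e: "e > 0" using r n by (simp add: e_def)
  have er: "e * (norm u + norm v) < r"
  proof -
    have "e * (norm u + norm v) < e * (norm u + norm v + 1)"
      using e by simp
    also have "\<dots> = r" using n by (simp add: e_def)
    finally show ?thesis .
  qed
  obtain y where y: "dist x y \<le> e * (norm u + norm v)"
    "f (x + e *\<^sub>R u + e *\<^sub>R v) - f (x + e *\<^sub>R u) - f (x + e *\<^sub>R v) + f x = e\<^sup>2 * ?a y"
    using second_difference[OF f fu e er] r(2) by (metis subsetD)
  obtain z where z: "dist x z \<le> e * (norm v + norm u)"
    "f (x + e *\<^sub>R v + e *\<^sub>R u) - f (x + e *\<^sub>R v) - f (x + e *\<^sub>R u) + f x = e\<^sup>2 * ?b z"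
    using second_difference[OF f fv e, of x r u] er r(2) by (metis add.commute subsetD)
  have "e\<^sup>2 * ?a y = e\<^sup>2 * ?b z"
    using y(2) z(2) by (simp add: algebra_simps)
  then have "?a y = ?b z" using e by simp
  moreover have "dist (?a y) (?a x) < d" "dist (?b z) (?b x) < d"
    using y(1) z(1) er
    by (intro r1(2) r2(2); simp add: r_def dist_commute add.commute)+
  ultimately show False
    using abs_triangle_ineq4[of "?a x - ?a y" "?b x - ?b z"] unfolding d_def dist_real_def
    by (simp add: abs_minus_commute)
qed

lemma second_derivative_symmetric:
  fixes f :: "'a::euclidean_space \<Rightarrow> 'b::euclidean_space"
  assumes sm: "smooth_on f S" and S: "open S" "x \<in> S"
  shows "dderiv (\<lambda>y. dderiv f u y) v x = dderiv (\<lambda>y. dderiv f v y) u x"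
proof (rule euclidean_eqI)
  fix b :: 'b
  have D: "((\<lambda>y. h y \<bullet> b) has_derivative (\<lambda>w. dderiv h w y \<bullet> b)) (at y)"
    if "smooth_on h S" "y \<in> S" for h :: "'a \<Rightarrow> 'b" and y
    by (rule has_derivative_inner_left) (rule smooth_on_has_derivative[OF that])
  have C: "continuous_on S (\<lambda>y. dderiv (\<lambda>y. dderiv f w y) w' y \<bullet> b)" for w w'
    by (intro continuous_intros smooth_on_continuous smooth_on_dderiv sm)
  show "dderiv (\<lambda>y. dderiv f u y) v x \<bullet> b = dderiv (\<lambda>y. dderiv f v y) u x \<bullet> b"
    by (rule second_derivative_symmetric_real[OF D[OF sm] D[OF smooth_on_dderiv[OF sm]]
          D[OF smooth_on_dderiv[OF sm]] C C S])
qed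

lemma bilinear_expand:
  fixes B :: "'a::euclidean_space \<Rightarrow> 'b::euclidean_space \<Rightarrow> 'c::real_vector"
  assumes "bilinear B"
  shows "B a b = (\<Sum>i\<in>Basis. \<Sum>j\<in>Basis. ((a \<bullet> i) * (b \<bullet> j)) *\<^sub>R B i j)"
proof -
  have "B a b = B (\<Sum>i\<in>Basis. (a \<bullet> i) *\<^sub>R i) (\<Sum>j\<in>Basis. (b \<bullet> j) *\<^sub>R j)"
    by (simp add: euclidean_representation)
  also have "\<dots> = (\<Sum>i\<in>Basis. (a \<bullet> i) *\<^sub>R B i (\<Sum>j\<in>Basis. (b \<bullet> j) *\<^sub>R j))"
    using assms linear_sum[of "\<lambda>x. B x (\<Sum>j\<in>Basis. (b \<bullet> j) *\<^sub>R j)" "\<lambda>i. (a \<bullet> i) *\<^sub>R i" Basis]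
      linear_scale[of "\<lambda>x. B x (\<Sum>j\<in>Basis. (b \<bullet> j) *\<^sub>R j)"]
    by (simp only: bilinear_def)
  also have "\<dots> = (\<Sum>i\<in>Basis. (a \<bullet> i) *\<^sub>R (\<Sum>j\<in>Basis. (b \<bullet> j) *\<^sub>R B i j))"
    using assms by (simp add: bilinear_def linear_sum linear_scale)
  finally show ?thesis by (simp add: scaleR_sum_right)
qed

text \<open>
  The product rule for a bilinear form whose coefficients vary with the base point. It serves for
  the metric and for the Christoffel symbols, both evaluated on vector fields along a map.
\<close>

lemma has_derivative_bilinear_field:
  fixes B :: "'a::real_normed_vector \<Rightarrow> 'b::euclidean_space \<Rightarrow> 'c::euclidean_space \<Rightarrow> 'd::real_normed_vector"
    and F :: "'g::real_normed_vector \<Rightarrow> 'a"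
  assumes S: "open S" "F x \<in> S"
    and bil: "\<And>y. y \<in> S \<Longrightarrow> bilinear (B y)"
    and dB: "\<And>a b. (\<lambda>y. B y a b) differentiable (at (F x))"
    and F: "(F has_derivative F') (at x)"
    and Y: "(Y has_derivative Y') (at x)"
    and Z: "(Z has_derivative Z') (at x)"
  shows "((\<lambda>x. B (F x) (Y x) (Z x)) has_derivative
    (\<lambda>t. dderiv (\<lambda>y. B y (Y x) (Z x)) (F' t) (F x) + B (F x) (Y' t) (Z x) + B (F x) (Y x) (Z' t))) (at x)"
proof -
  have dB': "((\<lambda>y. B y a b) has_derivative (\<lambda>t. dderiv (\<lambda>y. B y a b) t (F x))) (at (F x))" for a b
    by (rule differentiable_has_dderiv[OF dB])
  have expand: "dderiv (\<lambda>y. B y a b) t (F x) =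
      (\<Sum>i\<in>Basis. \<Sum>j\<in>Basis. ((a \<bullet> i) * (b \<bullet> j)) *\<^sub>R dderiv (\<lambda>y. B y i j) t (F x))" for a b t
  proof -
    have "dderiv (\<lambda>y. B y a b) t (F x) =
        dderiv (\<lambda>y. \<Sum>i\<in>Basis. \<Sum>j\<in>Basis. ((a \<bullet> i) * (b \<bullet> j)) *\<^sub>R B y i j) t (F x)"
      by (rule dderiv_cong[OF S]) (rule bilinear_expand[OF bil])
    also have "\<dots> = (\<Sum>i\<in>Basis. \<Sum>j\<in>Basis. ((a \<bullet> i) * (b \<bullet> j)) *\<^sub>R dderiv (\<lambda>y. B y i j) t (F x))"
      by (rule dderiv_eqI) (intro has_derivative_sum has_derivative_scaleR_right dB')
    finally show ?thesis .
  qed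
  let ?D = "\<lambda>t. \<Sum>i\<in>Basis. \<Sum>j\<in>Basis.
     ((Y x \<bullet> i) * (Z x \<bullet> j)) *\<^sub>R dderiv (\<lambda>y. B y i j) (F' t) (F x) +
     ((Y x \<bullet> i) * (Z' t \<bullet> j) + (Y' t \<bullet> i) * (Z x \<bullet> j)) *\<^sub>R B (F x) i j"
  have "((\<lambda>x. \<Sum>i\<in>Basis. \<Sum>j\<in>Basis. ((Y x \<bullet> i) * (Z x \<bullet> j)) *\<^sub>R B (F x) i j) has_derivative ?D) (at x)"
    by (intro has_derivative_sum has_derivative_scaleR has_derivative_mult has_derivative_inner_left
        Y Z has_derivative_compose[OF F dB'])
  moreover have "eventually (\<lambda>x. F x \<in> S) (at x)"
    using has_derivative_continuous[OF F] S by (simp add: continuous_within topological_tendstoD)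
  then have "eventually (\<lambda>x. (\<Sum>i\<in>Basis. \<Sum>j\<in>Basis. ((Y x \<bullet> i) * (Z x \<bullet> j)) *\<^sub>R B (F x) i j) =
      B (F x) (Y x) (Z x)) (at x)"
    by (rule eventually_mono) (simp flip: bilinear_expand[OF bil])
  ultimately have "((\<lambda>x. B (F x) (Y x) (Z x)) has_derivative ?D) (at x)"
    by (rule has_derivative_transform_eventually) (simp_all flip: bilinear_expand[OF bil[OF S(2)]] add: S)
  moreover have "?D = (\<lambda>t. dderiv (\<lambda>y. B y (Y x) (Z x)) (F' t) (F x) + B (F x) (Y' t) (Z x) + B (F x) (Y x) (Z' t))"
    by (rule ext, subst expand, subst (2 3) bilinear_expand[OF bil[OF S(2)]])
      (simp add: sum.distrib scaleR_add_left algebra_simps)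
  ultimately show ?thesis by simp
qed

section \<open>Differentiable families of scalar products\<close>

text \<open>
  Where one factor vanishes, mere continuity of the other factor suffices for the product rule.
\<close>

lemma has_derivative_scaleR_vanishing:
  fixes E :: "'a::real_normed_vector \<Rightarrow> 'b::real_normed_vector"
  assumes a: "continuous (at x) a" and E: "(E has_derivative E') (at x)" and E0: "E x = 0"
  shows "((\<lambda>y. a y *\<^sub>R E y) has_derivative (\<lambda>h. a x *\<^sub>R E' h)) (at x)"
proof -
  have bl: "bounded_linear E'" using E by (rule has_derivative_bounded_linear)
  obtain K where K: "\<And>h. norm (E' h) \<le> norm h * K"
    using bounded_linear.bounded[OF bl] by blast
  have lim: "((\<lambda>y. (E y - E' (y - x)) /\<^sub>R norm (y - x)) \<longlongrightarrow> 0) (at x)"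
    using E E0 by (simp add: has_derivative_at_within)
  have a0: "((\<lambda>y. a y - a x) \<longlongrightarrow> 0) (at x)"
    using a by (simp add: continuous_at LIM_zero)
  have 1: "((\<lambda>y. a y *\<^sub>R ((E y - E' (y - x)) /\<^sub>R norm (y - x))) \<longlongrightarrow> a x *\<^sub>R 0) (at x)"
    using a by (intro tendsto_scaleR lim) (simp add: continuous_at)
  have 2: "((\<lambda>y. (a y - a x) *\<^sub>R (E' (y - x) /\<^sub>R norm (y - x))) \<longlongrightarrow> 0) (at x)"
  proof (rule Lim_null_comparison)
    show "\<forall>\<^sub>F y in at x. norm ((a y - a x) *\<^sub>R (E' (y - x) /\<^sub>R norm (y - x))) \<le> norm (a y - a x) * K"
    proof (rule always_eventually, rule allI)
      fix y
      have "norm (E' (y - x) /\<^sub>R norm (y - x)) \<le> K" if "y \<noteq> x"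
        using K[of "y - x"] that by (simp add: divide_simps mult.commute)
      moreover have "norm (a y - a x) = 0" if "y = x" using that by simp
      ultimately show "norm ((a y - a x) *\<^sub>R (E' (y - x) /\<^sub>R norm (y - x))) \<le> norm (a y - a x) * K"
        by (metis mult_left_mono mult_zero_left norm_ge_zero norm_scaleR order_refl real_norm_def)
    qed
    show "((\<lambda>y. norm (a y - a x) * K) \<longlongrightarrow> 0) (at x)"
      using tendsto_mult_left_zero[OF tendsto_norm_zero[OF a0]] .
  qed
  have "((\<lambda>y. (a y *\<^sub>R E y - a x *\<^sub>R E x - a x *\<^sub>R E' (y - x)) /\<^sub>R norm (y - x)) \<longlongrightarrow> 0) (at x)"
    using tendsto_add[OF 1 2] E0 by (simp add: algebra_simps)
  then show ?thesis
    using bounded_linear_scaleR_right bl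
    by (simp add: has_derivative_at_within bounded_linear_compose[OF bounded_linear_scaleR_right])
qed

text \<open>
  The equation determines \<open>z\<close> implicitly, with coefficients \<open>E\<close> that vanish at \<open>x\<close>. Smallness of \<open>E\<close>
  first makes \<open>z\<close> bounded near \<open>x\<close>; then \<open>E \<rightarrow> 0\<close> makes it continuous at \<open>x\<close>; and then the sum on
  the right is differentiable by the previous lemma, hence so is \<open>z\<close>.
\<close>

lemma fixed_point_equation_differentiable:
  fixes z m :: "'a::real_normed_vector \<Rightarrow> 'b::euclidean_space"
  assumes eq: "eventually (\<lambda>y. z y = m y - (\<Sum>i\<in>Basis. (z y \<bullet> i) *\<^sub>R E i y)) (at x)"
    and eqx: "z x = m x"
    and m: "m differentiable (at x)"
    and E: "\<And>i. E i differentiable (at x)" "\<And>i. E i x = 0"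
  shows "z differentiable (at x)"
proof -
  have mc: "(m \<longlongrightarrow> m x) (at x)" and Ec: "(E i \<longlongrightarrow> 0) (at x)" for i
    using differentiable_imp_continuous_within[OF m] differentiable_imp_continuous_within[OF E(1)] E(2)
    by (simp_all add: continuous_within)
  have "((\<lambda>y. \<Sum>i\<in>Basis. norm (E i y)) \<longlongrightarrow> 0) (at x)"
    by (intro tendsto_null_sum tendsto_norm_zero Ec)
  then have sE: "eventually (\<lambda>y. (\<Sum>i\<in>Basis. norm (E i y)) < 1/2) (at x)"
    by (rule order_tendstoD) simp
  have "eventually (\<lambda>y. norm (m y) < norm (m x) + 1) (at x)"
    using tendsto_norm[OF mc] by (rule order_tendstoD) simp
  with sE eq have bd: "eventually (\<lambda>y. norm (z y) \<le> 2 * (norm (m x) + 1)) (at x)"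
  proof eventually_elim
    case (elim y)
    have "norm (\<Sum>i\<in>Basis. (z y \<bullet> i) *\<^sub>R E i y) \<le> (\<Sum>i\<in>Basis. norm (z y) * norm (E i y))"
      by (rule sum_norm_le) (simp add: Basis_le_norm mult_right_mono)
    also have "\<dots> = norm (z y) * (\<Sum>i\<in>Basis. norm (E i y))"
      by (simp add: sum_distrib_left)
    also have "\<dots> \<le> norm (z y) * (1/2)"
      using elim by (intro mult_left_mono) auto
    finally have "norm (z y) \<le> norm (m y) + norm (z y) * (1/2)"
      using elim(2) norm_triangle_ineq4[of "m y" "\<Sum>i\<in>Basis. (z y \<bullet> i) *\<^sub>R E i y"] by simp
    with elim show ?case by simp
  qed
  have "((\<lambda>y. (z y \<bullet> i) *\<^sub>R E i y) \<longlongrightarrow> 0) (at x)" for i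
  proof (rule Lim_null_comparison)
    show "\<forall>\<^sub>F y in at x. norm ((z y \<bullet> i) *\<^sub>R E i y) \<le> (2 * (norm (m x) + 1) * norm i) * norm (E i y)"
      using bd
    proof eventually_elim
      case (elim y)
      have "\<bar>z y \<bullet> i\<bar> \<le> norm (z y) * norm i" by (rule Cauchy_Schwarz_ineq2)
      also have "\<dots> \<le> 2 * (norm (m x) + 1) * norm i" using elim by (intro mult_right_mono) auto
      finally show ?case by (simp add: mult_right_mono)
    qed
    show "((\<lambda>y. (2 * (norm (m x) + 1) * norm i) * norm (E i y)) \<longlongrightarrow> 0) (at x)"
      by (intro tendsto_mult_right_zero tendsto_norm_zero Ec)
  qed
  then have "((\<lambda>y. m y - (\<Sum>i\<in>Basis. (z y \<bullet> i) *\<^sub>R E i y)) \<longlongrightarrow> m x - (\<Sum>i\<in>(Basis::'b set). 0)) (at x)"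
    by (intro tendsto_diff tendsto_sum mc)
  then have "(z \<longlongrightarrow> z x) (at x)"
    using eq by (simp add: eqx tendsto_cong)
  then have zc: "continuous (at x) (\<lambda>y. z y \<bullet> i)" for i
    by (auto intro: tendsto_inner simp: continuous_at)
  have "(\<lambda>y. m y - (\<Sum>i\<in>Basis. (z y \<bullet> i) *\<^sub>R E i y)) differentiable (at x)"
    using has_derivative_scaleR_vanishing[OF zc differentiable_has_dderiv[OF E(1)] E(2)]
    by (intro differentiable_diff m differentiable_sum) (auto simp: differentiable_def)
  then obtain D where "((\<lambda>y. m y - (\<Sum>i\<in>Basis. (z y \<bullet> i) *\<^sub>R E i y)) has_derivative D) (at x)"
    by (auto simp: differentiable_def)
  then have "(z has_derivative D) (at x)"
    by (rule has_derivative_transform_eventually) (use eq in \<open>auto simp: eqx E(2) elim: eventually_mono\<close>)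
  then show ?thesis by (auto simp: differentiable_def)
qed

lemma inner_product_linear_left: "is_inner_product B \<Longrightarrow> linear (\<lambda>u. B u v)"
  unfolding is_inner_product_def by (metis (no_types, lifting) ext)

lemma inner_product_bilinear: "is_inner_product B \<Longrightarrow> bilinear B"
  by (simp add: bilinear_def inner_product_linear_left) (simp add: is_inner_product_def)

lemma inner_product_eqI:
  assumes B: "is_inner_product B" and eq: "\<And>w. B u w = B v w"
  shows "u = v"
proof (rule ccontr)
  assume "u \<noteq> v"
  then have "B (u - v) (u - v) > 0"
    using B by (simp add: is_inner_product_def)
  moreover have "B (u - v) (u - v) = B u (u - v) - B v (u - v)"
    using inner_product_linear_left[OF B] by (rule linear_diff)
  ultimately show False using eq by simp
qed

text \<open>
  The operator \<open>z \<mapsto> B z\<close>, where a linear form is represented by its values on the standard basis.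
  For a scalar product it is invertible.
\<close>

definition gram :: "('e::euclidean_space \<Rightarrow> 'e \<Rightarrow> real) \<Rightarrow> 'e \<Rightarrow> 'e" where
  "gram B z = (\<Sum>b\<in>Basis. B z b *\<^sub>R b)"

lemma gram_eq_iff:
  assumes "linear (B z)" "linear k"
  shows "gram B z = (\<Sum>b\<in>Basis. k b *\<^sub>R b) \<longleftrightarrow> B z = k"
proof
  assume *: "gram B z = (\<Sum>b\<in>Basis. k b *\<^sub>R b)"
  have "B z b = k b" if "b \<in> Basis" for b
    using arg_cong[OF *, of "\<lambda>x. x \<bullet> b"] that by (simp add: gram_def inner_sum_left_Basis)
  then show "B z = k"
    using assms linear_eq_stdbasis by blast
qed (simp add: gram_def)

lemma linear_gram:
  assumes "\<And>b. linear (\<lambda>a. B a b)" shows "linear (gram B)"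
  using assms unfolding gram_def linear_iff
  by (simp add: scaleR_add_left sum.distrib scaleR_sum_right)

lemma inj_gram: assumes B: "is_inner_product B" shows "inj (gram B)"
proof (rule injI)
  fix u v assume "gram B u = gram B v"
  then have "B u = B v"
    using gram_eq_iff[of B u "B v"] B by (simp add: is_inner_product_def gram_def)
  then show "u = v" using inner_product_eqI[OF B] by metis
qed

lemma riesz:
  assumes B: "is_inner_product B" and k: "linear k"
  shows "\<exists>z. \<forall>w. B z w = k w"
proof -
  have "surj (gram B)"
    by (rule linear_injective_imp_surjective[OF linear_gram[OF inner_product_linear_left[OF B]] inj_gram[OF B] refl])
  then obtain z where "gram B z = (\<Sum>b\<in>Basis. k b *\<^sub>R b)" by (metis surjD)
  then have "B z = k" using gram_eq_iff[of B z k] k B by (simp add: is_inner_product_def)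
  then show ?thesis by auto
qed

lemma the_riesz:
  assumes B: "is_inner_product B" and k: "linear k"
  shows "B (THE z. \<forall>w. B z w = k w) w = k w"
proof -
  have "\<exists>!z. \<forall>w. B z w = k w"
    using riesz[OF B k] by (auto intro!: inner_product_eqI[OF B])
  from theI'[OF this] show ?thesis by blast
qed

text \<open>
  The vector representing a differentiable family of linear forms with respect to a differentiable
  family of scalar products is differentiable. Applying the inverse of the Gram operator at the
  single point \<open>x\<close> to the defining equation turns it into the equation of
  \<open>fixed_point_equation_differentiable\<close>, in which the perturbation \<open>E\<close> is the change of the Gram
  operator.
\<close>

lemma riesz_differentiable:
  fixes B :: "'a::real_normed_vector \<Rightarrow> 'e::euclidean_space \<Rightarrow> 'e \<Rightarrow> real"
  assumes S: "open S" "x \<in> S"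
    and inner: "\<And>y. y \<in> S \<Longrightarrow> is_inner_product (B y)"
    and dB: "\<And>a b. (\<lambda>y. B y a b) differentiable (at x)"
    and z: "\<And>y w. y \<in> S \<Longrightarrow> B y (z y) w = k y w"
    and dk: "\<And>w. (\<lambda>y. k y w) differentiable (at x)"
  shows "z differentiable (at x)"
proof -
  have lin: "linear (gram (B y))" if "y \<in> S" for y
    by (rule linear_gram[OF inner_product_linear_left[OF inner[OF that]]])
  obtain L where L: "linear L" "L \<circ> gram (B x) = id"
    using linear_injective_left_inverse[OF lin inj_gram[OF inner]] S by blast
  have Ld: "(\<lambda>y. L (h y)) differentiable (at x)" if "h differentiable (at x)" for h :: "'a \<Rightarrow> 'e"
    using that bounded_linear_imp_differentiable[OF linear_linear[THEN iffD2, OF L(1)]]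
    by (metis differentiable_compose)
  have dg: "(\<lambda>y. gram (B y) i) differentiable (at x)" for i
    unfolding gram_def by (intro differentiable_sum ballI differentiable_scaleR dB differentiable_const) simp
  define E where "E = (\<lambda>i y. L (gram (B y) i - gram (B x) i))"
  define m where "m = (\<lambda>y. L (\<Sum>b\<in>Basis. k y b *\<^sub>R b))"
  have rep: "(\<Sum>i\<in>Basis. (v \<bullet> i) *\<^sub>R gram (B y) i) = gram (B y) v" if "y \<in> S" for y v
    using linear_sum[OF lin[OF that], of "\<lambda>i. (v \<bullet> i) *\<^sub>R i" Basis]
    by (simp add: linear_scale[OF lin[OF that]] euclidean_representation)
  have key: "z y = m y - (\<Sum>i\<in>Basis. (z y \<bullet> i) *\<^sub>R E i y)" if "y \<in> S" for y
  proof -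
    have "(\<Sum>i\<in>Basis. (z y \<bullet> i) *\<^sub>R E i y)
        = L ((\<Sum>i\<in>Basis. (z y \<bullet> i) *\<^sub>R gram (B y) i) - (\<Sum>i\<in>Basis. (z y \<bullet> i) *\<^sub>R gram (B x) i))"
      unfolding E_def
      by (simp add: linear_sum[OF L(1)] linear_diff[OF L(1)] linear_scale[OF L(1)] sum_subtractf
          scaleR_diff_right)
    also have "\<dots> = L (gram (B y) (z y) - gram (B x) (z y))"
      by (simp only: rep[OF that] rep[OF S(2)])
    also have "L (gram (B y) (z y) - gram (B x) (z y)) = L (gram (B y) (z y)) - z y"
      using L by (simp add: linear_diff pointfree_idE)
    also have "gram (B y) (z y) = (\<Sum>b\<in>Basis. k y b *\<^sub>R b)"
      using z[OF that] by (simp add: gram_def)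
    finally show ?thesis by (simp add: m_def)
  qed
  show ?thesis
  proof (rule fixed_point_equation_differentiable)
    show "eventually (\<lambda>y. z y = m y - (\<Sum>i\<in>Basis. (z y \<bullet> i) *\<^sub>R E i y)) (at x)"
      using key S by (auto simp: eventually_at_topological)
    show "E i x = 0" for i using L(1) by (simp add: E_def linear_0)
    then show "z x = m x" using key[OF S(2)] by simp
    show "m differentiable (at x)"
      unfolding m_def by (intro Ld differentiable_sum ballI differentiable_scaleR dk differentiable_const) simp
    show "E i differentiable (at x)" for i
      unfolding E_def by (intro Ld differentiable_diff dg differentiable_const)
  qed
qed

section \<open>The Levi-Civita connection of a metric on an open set\<close>

text \<open>
  The Christoffel symbols of the first kind, that is, the right-hand side of the Koszul formula for
  constant vector fields. They are explicit in the metric, and hence defined for the pull-back of a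
  metric under any map.
\<close>

definition koszul :: "('e::euclidean_space \<Rightarrow> 'e \<Rightarrow> 'e \<Rightarrow> real) \<Rightarrow> 'e \<Rightarrow> 'e \<Rightarrow> 'e \<Rightarrow> 'e \<Rightarrow> real" where
  "koszul G x u v w =
     (dderiv (\<lambda>y. G y v w) u x + dderiv (\<lambda>y. G y u w) v x - dderiv (\<lambda>y. G y u v) w x) / 2"

locale local_metric =
  fixes G :: "'f::euclidean_space \<Rightarrow> 'f \<Rightarrow> 'f \<Rightarrow> real" and S :: "'f set"
  assumes open_S: "open S"
    and inner: "x \<in> S \<Longrightarrow> is_inner_product (G x)"
    and smooth: "smooth_on (\<lambda>x. G x u v) S"
begin

lemma sym: "x \<in> S \<Longrightarrow> G x u v = G x v u"
  using inner by (simp add: is_inner_product_def)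

lemma linear1: "x \<in> S \<Longrightarrow> linear (\<lambda>u. G x u v)"
  using inner inner_product_linear_left by blast

lemma linear2: "x \<in> S \<Longrightarrow> linear (G x u)"
  using inner by (simp add: is_inner_product_def)

lemmas G_simps = linear_add[OF linear1] linear_diff[OF linear1] linear_scale[OF linear1]
  linear_add[OF linear2] linear_diff[OF linear2] linear_scale[OF linear2]
  linear_0[OF linear1] linear_0[OF linear2] linear_neg[OF linear1] linear_neg[OF linear2]

lemma has_dG: "x \<in> S \<Longrightarrow> ((\<lambda>y. G y u v) has_derivative (\<lambda>w. dderiv (\<lambda>y. G y u v) w x)) (at x)"
  by (rule smooth_on_has_derivative[OF smooth])

lemma linear_dG: "x \<in> S \<Longrightarrow> linear (\<lambda>w. dderiv (\<lambda>y. G y u v) w x)"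
  by (rule has_derivative_linear[OF has_dG])

lemma dG_sym: "x \<in> S \<Longrightarrow> dderiv (\<lambda>y. G y u v) w x = dderiv (\<lambda>y. G y v u) w x"
  by (rule dderiv_cong[OF open_S]) (auto intro: sym)

lemma linear_dG2: assumes x: "x \<in> S" shows "linear (\<lambda>v. dderiv (\<lambda>y. G y u v) w x)"
proof (rule linearI)
  fix v v' and a :: real
  have "dderiv (\<lambda>y. G y u (v + v')) w x = dderiv (\<lambda>y. G y u v + G y u v') w x"
    by (rule dderiv_cong[OF open_S x]) (simp add: G_simps)
  also have "\<dots> = dderiv (\<lambda>y. G y u v) w x + dderiv (\<lambda>y. G y u v') w x"
    by (rule dderiv_eqI) (intro has_derivative_add has_dG x)
  finally show "dderiv (\<lambda>y. G y u (v + v')) w x = dderiv (\<lambda>y. G y u v) w x + dderiv (\<lambda>y. G y u v') w x" .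
  have "dderiv (\<lambda>y. G y u (a *\<^sub>R v)) w x = dderiv (\<lambda>y. a * G y u v) w x"
    by (rule dderiv_cong[OF open_S x]) (simp add: G_simps)
  also have "\<dots> = a * dderiv (\<lambda>y. G y u v) w x"
    by (rule dderiv_eqI) (intro has_derivative_mult_right has_dG x)
  finally show "dderiv (\<lambda>y. G y u (a *\<^sub>R v)) w x = a *\<^sub>R dderiv (\<lambda>y. G y u v) w x" by simp
qed

lemma linear_dG1: assumes x: "x \<in> S" shows "linear (\<lambda>v. dderiv (\<lambda>y. G y v u) w x)"
  using linear_dG2[OF x, of u w] by (simp add: dG_sym[OF x, of _ u])

lemmas dG_simps = linear_add[OF linear_dG] linear_scale[OF linear_dG]
  linear_add[OF linear_dG1] linear_scale[OF linear_dG1]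
  linear_add[OF linear_dG2] linear_scale[OF linear_dG2]

lemma koszul_sym: "x \<in> S \<Longrightarrow> koszul G x u v w = koszul G x v u w"
  using dG_sym[of x u v] by (simp add: koszul_def)

lemma linear_koszul3: "x \<in> S \<Longrightarrow> linear (koszul G x u v)"
  unfolding koszul_def by (rule linearI) (simp_all add: dG_simps algebra_simps add_divide_distrib diff_divide_distrib)

lemma linear_koszul2: "x \<in> S \<Longrightarrow> linear (\<lambda>v. koszul G x u v w)"
  unfolding koszul_def by (rule linearI) (simp_all add: dG_simps algebra_simps add_divide_distrib diff_divide_distrib)

lemma has_derivative_koszul:
  assumes x: "x \<in> S"
  shows "((\<lambda>y. koszul G y u v w) has_derivative (\<lambda>t.
     (dderiv (\<lambda>y. dderiv (\<lambda>y. G y v w) u y) t x + dderiv (\<lambda>y. dderiv (\<lambda>y. G y u w) v y) t x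
       - dderiv (\<lambda>y. dderiv (\<lambda>y. G y u v) w y) t x) / 2)) (at x)"
  unfolding koszul_def divide_inverse
  by (intro has_derivative_mult_left has_derivative_diff has_derivative_add
      smooth_on_has_derivative[OF smooth_on_dderiv[OF smooth] x])

lemma koszul_formula: assumes x: "x \<in> S" shows "G x (christoffel G x u v) w = koszul G x u v w"
proof -
  have "christoffel G x u v = (THE z. \<forall>w. G x z w = koszul G x u v w)"
    by (simp add: christoffel_def koszul_def field_simps)
  then show ?thesis by (simp add: the_riesz[OF inner[OF x] linear_koszul3[OF x]])
qed

lemma vector_eqI: "x \<in> S \<Longrightarrow> (\<And>w. G x u w = G x v w) \<Longrightarrow> u = v"
  using inner_product_eqI[OF inner] by blast

lemma christoffel_sym: "x \<in> S \<Longrightarrow> christoffel G x u v = christoffel G x v u"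
  by (rule vector_eqI) (auto simp: koszul_formula koszul_sym)

lemma christoffel_linear2: assumes x: "x \<in> S" shows "linear (christoffel G x u)"
  by (rule linearI; rule vector_eqI[OF x])
    (simp_all add: G_simps x koszul_formula linear_add[OF linear_koszul2] linear_scale[OF linear_koszul2])

lemma christoffel_bilinear: assumes x: "x \<in> S" shows "bilinear (christoffel G x)"
  using christoffel_linear2[OF x] by (simp add: bilinear_def christoffel_sym[OF x, of _ v for v])

lemma christoffel_differentiable:
  assumes x: "x \<in> S" shows "(\<lambda>y. christoffel G y u v) differentiable (at x)"
proof (rule riesz_differentiable[OF open_S x inner])
  show "(\<lambda>y. G y a b) differentiable (at x)" for a b
    by (rule smooth_on_differentiable[OF smooth x])
  show "G y (christoffel G y u v) w = koszul G y u v w" if "y \<in> S" for y w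
    by (rule koszul_formula[OF that])
  show "(\<lambda>y. koszul G y u v w) differentiable (at x)" for w
    using has_derivative_koszul[OF x] differentiable_def by blast
qed

text \<open>
  The Levi-Civita connection is metric: in the sum of the two Koszul expressions all terms but the
  derivative in direction \<open>u\<close> cancel.
\<close>

lemma metric_compatible:
  assumes x: "x \<in> S"
  shows "dderiv (\<lambda>y. G y v w) u x = G x (christoffel G x u v) w + G x v (christoffel G x u w)"
  unfolding sym[OF x, of v] koszul_formula[OF x] koszul_def
  using dG_sym[OF x, of v w] dG_sym[OF x, of u w] dG_sym[OF x, of u v] by (simp add: field_simps)

end

section \<open>Covariant derivatives along a map\<close>

locale metric_map = local_metric G S
  for G :: "'f::euclidean_space \<Rightarrow> 'f \<Rightarrow> 'f \<Rightarrow> real" and S +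
  fixes F :: "'e::euclidean_space \<Rightarrow> 'f" and W :: "'e set"
  assumes open_W: "open W"
    and smooth_F: "smooth_on F W"
    and maps: "x \<in> W \<Longrightarrow> F x \<in> S"
begin

text \<open>
  The covariant derivative in direction \<open>u\<close> of a vector field \<open>Y\<close> along \<open>F\<close>.
\<close>

definition cov :: "('e \<Rightarrow> 'f) \<Rightarrow> 'e \<Rightarrow> 'e \<Rightarrow> 'f" where
  "cov Y u x = dderiv Y u x + christoffel G (F x) (dderiv F u x) (Y x)"

text \<open>
  The covariant derivative of the field \<open>dF(v)\<close> along \<open>F\<close>. For a coordinate representation of a
  hypersurface this is the ambient derivative of the Gauss formula; for \<open>F = id\<close> it is the
  Christoffel symbol.
\<close>

definition hess :: "'e \<Rightarrow> 'e \<Rightarrow> 'e \<Rightarrow> 'f" where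
  "hess u v x = cov (dderiv F v) u x"

definition pullback :: "'e \<Rightarrow> 'e \<Rightarrow> 'e \<Rightarrow> real" where
  "pullback x u v = G (F x) (dderiv F u x) (dderiv F v x)"

lemma has_dF: "x \<in> W \<Longrightarrow> (F has_derivative (\<lambda>u. dderiv F u x)) (at x)"
  by (rule smooth_on_has_derivative[OF smooth_F])

lemma linear_dF: "x \<in> W \<Longrightarrow> linear (\<lambda>u. dderiv F u x)"
  by (rule has_derivative_linear[OF has_dF])

lemma has_ddF: "x \<in> W \<Longrightarrow> (dderiv F v has_derivative (\<lambda>u. dderiv (dderiv F v) u x)) (at x)"
  using smooth_on_has_derivative[OF smooth_on_dderiv[OF smooth_F]] by simp

lemma hess_sym: assumes x: "x \<in> W" shows "hess u v x = hess v u x"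
  using second_derivative_symmetric[OF smooth_F open_W x] christoffel_sym[OF maps[OF x]]
  by (simp add: hess_def cov_def)

lemma metric_compatible_along:
  assumes x: "x \<in> W" and Y: "Y differentiable (at x)" and Z: "Z differentiable (at x)"
  shows "dderiv (\<lambda>x. G (F x) (Y x) (Z x)) u x = G (F x) (cov Y u x) (Z x) + G (F x) (Y x) (cov Z u x)"
proof -
  have "dderiv (\<lambda>x. G (F x) (Y x) (Z x)) u x =
     dderiv (\<lambda>y. G y (Y x) (Z x)) (dderiv F u x) (F x)
     + G (F x) (dderiv Y u x) (Z x) + G (F x) (Y x) (dderiv Z u x)"
    by (rule dderiv_eqI, rule has_derivative_bilinear_field[OF open_S maps[OF x]
        inner_product_bilinear[OF inner] smooth_on_differentiable[OF smooth maps[OF x]] has_dF[OF x]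
        differentiable_has_dderiv[OF Y] differentiable_has_dderiv[OF Z]])
  then show ?thesis
    by (simp add: metric_compatible[OF maps[OF x]] cov_def G_simps[OF maps[OF x]])
qed

lemma ddF_differentiable: "x \<in> W \<Longrightarrow> dderiv F v differentiable (at x)"
  using has_ddF differentiable_def by blast

lemma dderiv_pullback:
  assumes x: "x \<in> W"
  shows "dderiv (\<lambda>y. pullback y v w) u x =
    G (F x) (hess u v x) (dderiv F w x) + G (F x) (dderiv F v x) (hess u w x)"
  unfolding pullback_def hess_def
  by (rule metric_compatible_along[OF x ddF_differentiable[OF x] ddF_differentiable[OF x]])

text \<open>
  The product of \<open>hess u v\<close> with a tangent vector depends only on the pulled-back metric. The reason
  is that of the Koszul formula: \<open>hess\<close> is symmetric and compatible with the metric.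
\<close>

lemma koszul_pullback:
  assumes x: "x \<in> W"
  shows "koszul pullback x u v w = G (F x) (hess u v x) (dderiv F w x)"
  using sym[OF maps[OF x]] hess_sym[OF x]
  by (simp add: koszul_def dderiv_pullback[OF x])

lemma has_derivative_hess:
  assumes x: "x \<in> W"
  shows "(hess v w has_derivative (\<lambda>u. dderiv (\<lambda>x. dderiv (dderiv F w) v x) u x
     + (dderiv (\<lambda>y. christoffel G y (dderiv F v x) (dderiv F w x)) (dderiv F u x) (F x)
        + christoffel G (F x) (dderiv (dderiv F v) u x) (dderiv F w x)
        + christoffel G (F x) (dderiv F v x) (dderiv (dderiv F w) u x)))) (at x)"
proof -
  have "(\<lambda>x. dderiv (dderiv F w) v x + christoffel G (F x) (dderiv F v x) (dderiv F w x)) = hess v w"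
    by (simp add: fun_eq_iff hess_def cov_def)
  moreover have "((\<lambda>x. dderiv (dderiv F w) v x + christoffel G (F x) (dderiv F v x) (dderiv F w x))
     has_derivative (\<lambda>u. dderiv (\<lambda>x. dderiv (dderiv F w) v x) u x
     + (dderiv (\<lambda>y. christoffel G y (dderiv F v x) (dderiv F w x)) (dderiv F u x) (F x)
        + christoffel G (F x) (dderiv (dderiv F v) u x) (dderiv F w x)
        + christoffel G (F x) (dderiv F v x) (dderiv (dderiv F w) u x)))) (at x)"
    by (intro has_derivative_add has_derivative_bilinear_field[OF open_S maps[OF x] christoffel_bilinear
        christoffel_differentiable[OF maps[OF x]] has_dF[OF x] has_ddF[OF x] has_ddF[OF x]]
        smooth_on_has_derivative[OF smooth_on_dderiv[OF smooth_on_dderiv[OF smooth_F]] x])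
  ultimately show ?thesis by simp
qed

lemma hess_differentiable: "x \<in> W \<Longrightarrow> hess v w differentiable (at x)"
  using has_derivative_hess differentiable_def by blast

text \<open>
  Covariant derivatives along \<open>F\<close> commute up to the curvature of the target. The third and the mixed
  second derivatives of \<open>F\<close> cancel by symmetry.
\<close>

lemma curvature_along:
  assumes x: "x \<in> W"
  shows "cov (hess v w) u x - cov (hess u w) v x
    = curvature_in G (F x) (dderiv F u x) (dderiv F v x) (dderiv F w x)"
proof -
  have h: "dderiv (hess v w) u x = dderiv (\<lambda>x. dderiv (dderiv F w) v x) u x
     + (dderiv (\<lambda>y. christoffel G y (dderiv F v x) (dderiv F w x)) (dderiv F u x) (F x)
        + christoffel G (F x) (dderiv (dderiv F v) u x) (dderiv F w x)
        + christoffel G (F x) (dderiv F v x) (dderiv (dderiv F w) u x))" for u v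
    by (rule dderiv_eqI[OF has_derivative_hess[OF x]])
  have s3: "dderiv (\<lambda>x. dderiv (dderiv F w) v x) u x = dderiv (\<lambda>x. dderiv (dderiv F w) u x) v x"
    by (rule second_derivative_symmetric[OF smooth_on_dderiv[OF smooth_F] open_W x])
  have s2: "dderiv (dderiv F v) u x = dderiv (dderiv F u) v x"
    using second_derivative_symmetric[OF smooth_F open_W x] by simp
  have "hess v w x = dderiv (dderiv F w) v x + christoffel G (F x) (dderiv F v x) (dderiv F w x)" for v
    by (simp add: hess_def cov_def)
  then show ?thesis
    by (simp add: cov_def curvature_in_def h s3 s2 linear_add[OF christoffel_linear2[OF maps[OF x]]])
qed

text \<open>
  The left-hand side depends only on the pulled-back metric. Hence two maps which induce the same
  metric can be compared: this is the common source of the intrinsic curvature formula and of the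
  Gauss equation.
\<close>

lemma curvature_pullback:
  assumes x: "x \<in> W"
  shows "dderiv (\<lambda>y. koszul pullback y v w z) u x - dderiv (\<lambda>y. koszul pullback y u w z) v x =
     G (F x) (curvature_in G (F x) (dderiv F u x) (dderiv F v x) (dderiv F w x)) (dderiv F z x)
     + G (F x) (hess v w x) (hess u z x) - G (F x) (hess u w x) (hess v z x)"
proof -
  have "dderiv (\<lambda>y. koszul pullback y v w z) u x
      = G (F x) (cov (hess v w) u x) (dderiv F z x) + G (F x) (hess v w x) (hess u z x)" for u v
  proof -
    have "dderiv (\<lambda>y. koszul pullback y v w z) u x = dderiv (\<lambda>y. G (F y) (hess v w y) (dderiv F z y)) u x"
      by (rule dderiv_cong[OF open_W x]) (rule koszul_pullback)
    then show ?thesis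
      by (simp add: metric_compatible_along[OF x hess_differentiable[OF x] ddF_differentiable[OF x]] flip: hess_def)
  qed
  then show ?thesis
    by (simp add: curvature_along[OF x, symmetric] G_simps[OF maps[OF x]])
qed

end

section \<open>Curvature and its symmetries\<close>

context local_metric
begin

text \<open>
  The instance \<open>F = id\<close> of \<open>curvature_pullback\<close>.
\<close>

lemma curvature_koszul:
  assumes x: "x \<in> S"
  shows "dderiv (\<lambda>y. koszul G y v w z) u x - dderiv (\<lambda>y. koszul G y u w z) v x =
     G x (curvature_in G x u v w) z
     + G x (christoffel G x v w) (christoffel G x u z) - G x (christoffel G x u w) (christoffel G x v z)"
proof -
  \<comment> \<open>the identity has constant first derivatives\<close>
  have "Ck_on k (\<lambda>x. a::'f) S" for k a
    by (induction k arbitrary: a) auto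
  moreover have "Ck_on k (\<lambda>x. x) S" for k
    using calculation by (cases k) auto
  ultimately have "smooth_on (\<lambda>x. x) S"
    by (simp add: smooth_on_def)
  then interpret metric_map G S "\<lambda>x. x" S
    by unfold_locales (auto intro: open_S)
  have "pullback = G" by (simp add: pullback_def fun_eq_iff)
  moreover have "hess u v x = christoffel G x u v" for u v
    by (simp add: hess_def cov_def frechet_derivative_ident)
  ultimately show ?thesis using curvature_pullback[OF x, of v w z u] by simp
qed

text \<open>
  The curvature tensor in terms of second derivatives of the metric. In the Koszul expressions the
  derivatives \<open>D u v w z\<close> and \<open>D v u w z\<close> cancel, and the remaining terms display all symmetries of
  the tensor.
\<close>

lemma curvature_formula:
  assumes x: "x \<in> S"
  defines "D \<equiv> \<lambda>u v a b. dderiv (\<lambda>y. dderiv (\<lambda>y. G y a b) v y) u x"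
  shows "G x (curvature_in G x u v w) z = (D u w v z - D u z v w - D v w u z + D v z u w) / 2
     - G x (christoffel G x v w) (christoffel G x u z) + G x (christoffel G x u w) (christoffel G x v z)"
proof -
  have A: "dderiv (\<lambda>y. koszul G y v w z) u x = (D u v w z + D u w v z - D u z v w) / 2" for u v
    unfolding D_def by (rule dderiv_eqI[OF has_derivative_koszul[OF x]])
  have "D u v w z = D v u w z"
    unfolding D_def by (rule second_derivative_symmetric[OF smooth open_S x])
  then show ?thesis
    using curvature_koszul[OF x, of v w z u] unfolding A[of u v] A[of v u] by (simp add: field_simps)
qed

lemma curvature_symmetries:
  assumes x: "x \<in> S"
  shows curvature_antisym: "G x (curvature_in G x u v w) z = - G x (curvature_in G x v u w) z"
    and curvature_pair_sym: "G x (curvature_in G x u v w) z = G x (curvature_in G x w z u) v"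
    and bianchi: "G x (curvature_in G x u v w) z + G x (curvature_in G x v w u) z + G x (curvature_in G x w u v) z = 0"
proof -
  define D where "D = (\<lambda>u v a b. dderiv (\<lambda>y. dderiv (\<lambda>y. G y a b) v y) u x)"
  define g where "g = (\<lambda>u v w z. G x (christoffel G x u v) (christoffel G x w z))"
  have D1: "D u v a b = D v u a b" for u v a b
    unfolding D_def by (rule second_derivative_symmetric[OF smooth open_S x])
  have D2: "D u v a b = D u v b a" for u v a b
    unfolding D_def by (rule dderiv_cong[OF open_S x]) (rule dG_sym)
  have g1: "g u v w z = g v u w z" and g2: "g u v w z = g u v z w" and g3: "g u v w z = g w z u v" for u v w z
    unfolding g_def using christoffel_sym[OF x] sym[OF x] by auto
  have R: "G x (curvature_in G x u v w) z =
      (D u w v z - D u z v w - D v w u z + D v z u w) / 2 - g v w u z + g u w v z" for u v w z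
    using curvature_formula[OF x] by (simp add: D_def g_def)
  show "G x (curvature_in G x u v w) z = - G x (curvature_in G x v u w) z"
    by (simp add: R field_simps)
  show "G x (curvature_in G x u v w) z = G x (curvature_in G x w z u) v"
    by (simp add: R D1 D2 g1 g2 g3)
  show "G x (curvature_in G x u v w) z + G x (curvature_in G x v w u) z + G x (curvature_in G x w u v) z = 0"
    by (simp add: R D1 D2 g1 g2 g3) (simp add: field_simps)
qed

end

section \<open>The Gauss equation\<close>

context metric_map
begin

text \<open>
  The vector-valued second fundamental form of \<open>F\<close>, where \<open>g\<close> is the induced metric: the normal
  component of \<open>hess\<close>.
\<close>

definition II :: "('e \<Rightarrow> 'e \<Rightarrow> 'e \<Rightarrow> real) \<Rightarrow> 'e \<Rightarrow> 'e \<Rightarrow> 'e \<Rightarrow> 'f" where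
  "II g u v x = hess u v x - dderiv F (christoffel g x u v) x"

text \<open>
  By \<open>koszul_pullback\<close> the tangential component of \<open>hess u v\<close> is the Christoffel symbol of the induced
  metric. The Gauss equation is the difference of \<open>curvature_koszul\<close> for the induced metric and of
  \<open>curvature_pullback\<close>: the left-hand sides agree, and the products of tangential components cancel.
\<close>

lemma gauss:
  assumes g: "local_metric g W" and iso: "\<And>x u v. x \<in> W \<Longrightarrow> g x u v = pullback x u v"
    and x: "x \<in> W"
  shows II_normal: "G (F x) (II g u v x) (dderiv F w x) = 0"
    and gauss_equation: "g x (curvature_in g x u v w) z =
      G (F x) (curvature_in G (F x) (dderiv F u x) (dderiv F v x) (dderiv F w x)) (dderiv F z x)
      + G (F x) (II g v w x) (II g u z x) - G (F x) (II g u w x) (II g v z x)"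
proof -
  interpret g: local_metric g W by (rule g)
  note S = maps[OF x]
  have kos: "koszul g y u v w = koszul pullback y u v w" if "y \<in> W" for y u v w
    using dderiv_cong[OF open_W that, of "\<lambda>y. g y a b" "\<lambda>y. pullback y a b" for a b] iso
    by (simp add: koszul_def)
  have normal: "G (F x) (II g u v x) (dderiv F w x) = 0" for u v w
  proof -
    have "G (F x) (hess u v x) (dderiv F w x) = g x (christoffel g x u v) w"
      by (simp add: g.koszul_formula[OF x] kos[OF x] koszul_pullback[OF x])
    also have "\<dots> = G (F x) (dderiv F (christoffel g x u v) x) (dderiv F w x)"
      by (simp add: iso[OF x] pullback_def)
    finally show ?thesis by (simp add: II_def G_simps[OF S])
  qed
  then show "G (F x) (II g u v x) (dderiv F w x) = 0" .
  have normal': "G (F x) (dderiv F w x) (II g u v x) = 0" for u v w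
    using normal sym[OF S] by simp
  have split: "G (F x) (hess a b x) (hess a' b' x) =
      G (F x) (II g a b x) (II g a' b' x) + g x (christoffel g x a b) (christoffel g x a' b')" for a b a' b'
  proof -
    have "hess a b x = II g a b x + dderiv F (christoffel g x a b) x" for a b
      by (simp add: II_def)
    then have "G (F x) (hess a b x) (hess a' b' x) =
      G (F x) (II g a b x + dderiv F (christoffel g x a b) x) (II g a' b' x + dderiv F (christoffel g x a' b') x)"
      by simp
    then show ?thesis
      by (simp add: G_simps[OF S] normal normal' iso[OF x] pullback_def)
  qed
  have "dderiv (\<lambda>y. koszul g y v w z) u x = dderiv (\<lambda>y. koszul pullback y v w z) u x" for u v
    by (rule dderiv_cong[OF open_W x]) (rule kos)
  then show "g x (curvature_in g x u v w) z =
      G (F x) (curvature_in G (F x) (dderiv F u x) (dderiv F v x) (dderiv F w x)) (dderiv F z x)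
      + G (F x) (II g v w x) (II g u z x) - G (F x) (II g u w x) (II g v z x)"
    using g.curvature_koszul[OF x, of v w z u] curvature_pullback[OF x, of v w z u]
    by (simp add: split)
qed

end

section \<open>Spaces of constant sectional curvature\<close>

text \<open>
  A tensor with the symmetries of a curvature tensor is determined by its sectional curvatures.
  Polarising \<open>T u v v u = 0\<close> in both arguments makes \<open>T\<close> antisymmetric in the second and third slot
  as well; the cyclic sum of the Bianchi identity then becomes \<open>3 T\<close>.
\<close>

lemma curvature_tensor_eq_0:
  fixes T :: "'a::real_vector \<Rightarrow> 'a \<Rightarrow> 'a \<Rightarrow> 'a \<Rightarrow> real"
  assumes lin: "\<And>u v w. linear (T u v w)"
    and anti: "\<And>u v w z. T u v w z = - T v u w z"
    and pair: "\<And>u v w z. T u v w z = T w z u v"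
    and bianchi: "\<And>u v w z. T u v w z + T v w u z + T w u v z = 0"
    and zero: "\<And>u v. T u v v u = 0"
  shows "T u v w z = 0"
proof -
  have add4: "T u v w (z + z') = T u v w z + T u v w z'" for u v w z z'
    using linear_add[OF lin] .
  have add2: "T u (v + v') w z = T u v w z + T u v' w z" for u v v' w z
    unfolding pair[of u _ w z] by (rule add4)
  have add1: "T (u + u') v w z = T u v w z + T u' v w z" for u u' v w z
    using add2[of v u u' w z] anti[of "u + u'" v] anti[of u v] anti[of u' v] by simp
  have add3: "T u v (w + w') z = T u v w z + T u v w' z" for u v w w' z
    unfolding pair[of u v _ z] by (rule add1)
  have 34: "T u v w z = - T u v z w" for u v w z
    using pair[of u v w z] anti[of w z u v] pair[of z w u v] by simp
  have 1: "T u v v z = 0" for u v z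
  proof -
    have "T u v v z + T z v v u = 0"
      using zero[of "u + z" v] zero[of u v] zero[of z v] by (simp add: add1 add4)
    moreover have "T z v v u = T u v v z"
      using pair[of z v v u] anti[of v u] 34[of u v z v] by simp
    ultimately show ?thesis by simp
  qed
  have 2: "T u v w z = - T u w v z" for u v w z
    using 1[of u "v + w" z] 1[of u v z] 1[of u w z] by (simp add: add2 add3)
  have "T v w u z = T u v w z"
    using 2[of v w u z] anti[of u v w z] by simp
  moreover have "T w u v z = T u v w z"
    using anti[of w u v z] 2[of u w v z] by simp
  ultimately show ?thesis using bianchi[of u v w z] by simp
qed

text \<open>
  The strict Cauchy-Schwarz inequality, obtained from the component of \<open>u\<close> orthogonal to \<open>v\<close>. It makes
  the denominator of the sectional curvature nonzero.
\<close>

lemma gram_determinant_pos: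
  assumes B: "is_inner_product B" and ind: "u \<noteq> v" "independent {u, v}"
  shows "B u u * B v v - (B u v)\<^sup>2 > 0"
proof -
  have v: "v \<noteq> 0" and nu: "u \<notin> span {v}"
    using ind by (auto simp: independent_insert dependent_zero)
  let ?w = "B v v *\<^sub>R u - B u v *\<^sub>R v"
  have pos: "B v v > 0" using B v by (simp add: is_inner_product_def)
  have "?w \<noteq> 0"
  proof
    assume "?w = 0"
    then have "inverse (B v v) *\<^sub>R B v v *\<^sub>R u = inverse (B v v) *\<^sub>R B u v *\<^sub>R v"
      by simp
    then have "u = (inverse (B v v) * B u v) *\<^sub>R v"
      using pos by simp
    then show False using nu span_singleton by blast
  qed
  then have "B ?w ?w > 0" using B by (simp add: is_inner_product_def)
  moreover have "B v u = B u v" using B by (simp add: is_inner_product_def)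
  then have "B ?w ?w = B v v * (B u u * B v v - (B u v)\<^sup>2)"
    using inner_product_bilinear[OF B]
    by (simp add: bilinear_lsub bilinear_rsub bilinear_lmul bilinear_rmul power2_eq_square algebra_simps)
  ultimately show ?thesis using pos by (simp add: zero_less_mult_iff)
qed

lemma (in local_metric) constant_sectional_curvature:
  assumes x: "x \<in> S"
    and sec: "\<And>u v. u \<noteq> v \<Longrightarrow> independent {u, v} \<Longrightarrow>
      G x (curvature_in G x u v v) u / (G x u u * G x v v - (G x u v)\<^sup>2) = c"
  shows "G x (curvature_in G x u v w) z = c * (G x v w * G x u z - G x u w * G x v z)"
proof -
  define R where "R = (\<lambda>u v w z. G x (curvature_in G x u v w) z)"
  define T where "T = (\<lambda>u v w z. R u v w z - c * (G x v w * G x u z - G x u w * G x v z))"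
  have anti: "R u v w z = - R v u w z" for u v w z
    unfolding R_def by (rule curvature_antisym[OF x])
  have pair: "R u v w z = R w z u v" for u v w z
    unfolding R_def by (rule curvature_pair_sym[OF x])
  have R2: "linear (\<lambda>v. R u v w z)" for u w z
    unfolding pair[of u _ w z] by (simp add: R_def linear2[OF x])
  have zero: "T u v v u = 0" for u v
  proof (cases "u \<noteq> v \<and> independent {u, v}")
    case True
    with gram_determinant_pos[OF inner[OF x], of u v] sec[of u v] show ?thesis
      by (simp add: T_def R_def field_simps power2_eq_square sym[OF x, of v u])
  next
    case False
    have vv: "R v v w z = 0" for v w z using anti[of v v w z] by simp
    have wz: "R w z v v = 0" for v w z using pair vv by simp
    from False have "v = 0 \<or> u \<in> span {v}"
      by (auto simp: independent_insert span_base split: if_splits)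
    then consider "v = 0" | k where "u = k *\<^sub>R v"
      by (auto simp: span_singleton)
    then show ?thesis
    proof cases
      case 1
      then show ?thesis
        using linear_0[OF R2, of u v u] by (simp add: T_def G_simps[OF x])
    next
      case 2
      have "R (k *\<^sub>R v) v v (k *\<^sub>R v) = k * R (k *\<^sub>R v) v v v"
        using linear_scale[OF linear2[OF x]] by (simp add: R_def)
      then show ?thesis using 2 wz by (simp add: T_def G_simps[OF x])
    qed
  qed
  have "T u v w z = 0"
  proof (rule curvature_tensor_eq_0[of T])
    show "linear (T u v w)" for u v w
      by (rule linearI) (simp_all add: T_def R_def G_simps[OF x] algebra_simps)
    show "T u v w z = - T v u w z" for u v w z
      unfolding T_def using anti[of u v w z] by (simp add: algebra_simps)
    show "T u v w z = T w z u v" for u v w z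
      unfolding T_def using pair[of u v w z] sym[OF x, of w u] sym[OF x, of z v] sym[OF x, of z u]
        sym[OF x, of w v] by (simp add: algebra_simps)
    show "T u v w z + T v w u z + T w u v z = 0" for u v w z
      unfolding T_def using bianchi[OF x, of u v w z] sym[OF x, of v u] sym[OF x, of w u] sym[OF x, of w v]
      by (simp add: R_def algebra_simps)
  qed (rule zero)
  then show ?thesis by (simp add: T_def R_def)
qed

section \<open>Riemannian manifolds in charts\<close>

lemma Ck_on_subset: "Ck_on k h S \<Longrightarrow> T \<subseteq> S \<Longrightarrow> Ck_on k h T"
  by (induction k arbitrary: h) (auto intro: continuous_on_subset)

lemma smooth_on_subset: "smooth_on h S \<Longrightarrow> T \<subseteq> S \<Longrightarrow> smooth_on h T"
  by (auto simp: smooth_on_def intro: Ck_on_subset)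

lemma local_metric_subset: "local_metric G S \<Longrightarrow> open T \<Longrightarrow> T \<subseteq> S \<Longrightarrow> local_metric G T"
  unfolding local_metric_def by (blast intro: smooth_on_subset)

lemma chart_inv_chart:
  assumes "is_chart X c" "p \<in> fst c" shows "chart_inv c (snd c p) = p"
proof -
  have "topspace (subtopology X (fst c)) = fst c"
    using assms(1) openin_subset by (auto simp: is_chart_def)
  then have "inj_on (snd c) (fst c)"
    using assms(1) by (metis is_chart_def homeomorphic_imp_injective_map)
  then show ?thesis using assms(2) by (simp add: chart_inv_def)
qed

lemma chart_image_open:
  assumes c: "is_chart X c" and U: "openin X U" "U \<subseteq> fst c" shows "open (snd c ` U)"
proof -
  have "open_map (subtopology X (fst c)) (top_of_set (chart_image c)) (snd c)"
    using c by (simp add: is_chart_def homeomorphic_imp_open_map)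
  moreover have "openin (subtopology X (fst c)) U"
    using U by (auto simp: openin_subtopology)
  ultimately have "openin (top_of_set (chart_image c)) (snd c ` U)"
    by (simp add: open_map_def)
  then show ?thesis
    using c openin_open_trans by (auto simp: is_chart_def)
qed

locale smooth_atlas_on =
  fixes X :: "'m topology" and \<A> :: "('m, 'e::euclidean_space) chart set"
  assumes atlas: "smooth_atlas X \<A>"
begin

lemma chart: "c \<in> \<A> \<Longrightarrow> is_chart X c"
  using atlas by (simp add: smooth_atlas_def)

lemma inv_chart [simp]: "c \<in> \<A> \<Longrightarrow> p \<in> fst c \<Longrightarrow> chart_inv c (snd c p) = p"
  using chart_inv_chart[OF chart] .

lemma open_overlap:
  assumes "c \<in> \<A>" "d \<in> \<A>" shows "open (snd c ` (fst c \<inter> fst d))"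
  using chart[OF assms(1)] chart[OF assms(2)]
  by (intro chart_image_open) (auto simp: is_chart_def)

lemma transition_differentiable:
  assumes "c \<in> \<A>" "d \<in> \<A>" "p \<in> fst c" "p \<in> fst d"
  shows "(snd d \<circ> chart_inv c) differentiable (at (snd c p))"
proof (rule smooth_on_differentiable)
  show "smooth_on (snd d \<circ> chart_inv c) (snd c ` (fst c \<inter> fst d))"
    using atlas assms by (simp add: smooth_atlas_def)
qed (use assms in auto)

text \<open>
  The chain rule for \<open>h \<circ> chart_inv c\<close>, which near \<open>snd c p\<close> is \<open>h \<circ> chart_inv d\<close> after the transition map.
\<close>

lemma change_of_chart:
  fixes h :: "'m \<Rightarrow> 'v::real_normed_vector"
  assumes c: "c \<in> \<A>" "p \<in> fst c" and d: "d \<in> \<A>" "p \<in> fst d"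
    and h: "(h \<circ> chart_inv d) differentiable (at (snd d p))"
  shows "dderiv (h \<circ> chart_inv c) u (snd c p) =
    dderiv (h \<circ> chart_inv d) (dderiv (snd d \<circ> chart_inv c) u (snd c p)) (snd d p)"
proof -
  have 1: "((snd d \<circ> chart_inv c) has_derivative (\<lambda>u. dderiv (snd d \<circ> chart_inv c) u (snd c p))) (at (snd c p))"
    by (rule differentiable_has_dderiv[OF transition_differentiable]) (use c d in auto)
  have 2: "((h \<circ> chart_inv d) has_derivative (\<lambda>u. dderiv (h \<circ> chart_inv d) u (snd d p)))
      (at ((snd d \<circ> chart_inv c) (snd c p)))"
    using differentiable_has_dderiv[OF h] c by simp
  have "dderiv (h \<circ> chart_inv c) u (snd c p) = dderiv (\<lambda>x. (h \<circ> chart_inv d) ((snd d \<circ> chart_inv c) x)) u (snd c p)"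
    by (rule dderiv_cong[OF open_overlap[OF c(1) d(1)]]) (use c d in auto)
  also have "\<dots> = dderiv (h \<circ> chart_inv d) (dderiv (snd d \<circ> chart_inv c) u (snd c p)) (snd d p)"
    by (rule dderiv_eqI[OF has_derivative_compose[OF 1 2]])
  finally show ?thesis .
qed

lemma dderiv_chart_inv:
  assumes c: "c \<in> \<A>" "p \<in> fst c"
  shows "dderiv (snd c \<circ> chart_inv c) u (snd c p) = u"
proof -
  have "open (snd c ` fst c)"
    using open_overlap[OF c(1) c(1)] by simp
  then have "dderiv (snd c \<circ> chart_inv c) u (snd c p) = dderiv (\<lambda>x. x) u (snd c p)"
    by (rule dderiv_cong) (use c in auto)
  then show ?thesis by (simp add: frechet_derivative_ident)
qed

end

locale manifold =
  fixes M :: "('m, 'e::euclidean_space) riem_space"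
  assumes riem: "riemannian_manifold M"

sublocale manifold \<subseteq> smooth_atlas_on "top_of M" "atlas M"
  using riem by unfold_locales (simp add: riemannian_manifold_def)

context manifold
begin

lemma chart_at: assumes "p \<in> points M" shows "chart_at M p \<in> atlas M" "p \<in> fst (chart_at M p)"
proof -
  have "p \<in> (\<Union>c\<in>atlas M. fst c)"
    using atlas assms by (simp add: smooth_atlas_def points_def)
  then have "\<exists>c. c \<in> atlas M \<and> p \<in> fst c" by blast
  from someI_ex[OF this] show "chart_at M p \<in> atlas M" "p \<in> fst (chart_at M p)"
    by (simp_all add: chart_at_def)
qed

lemma chart_points: "c \<in> atlas M \<Longrightarrow> p \<in> fst c \<Longrightarrow> p \<in> points M"
  using atlas by (auto simp: smooth_atlas_def points_def)

lemma metric_inner: "p \<in> points M \<Longrightarrow> is_inner_product (metric M p)"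
  using riem by (simp add: riemannian_manifold_def)

lemma metric_in_chart:
  assumes "c \<in> atlas M" "p \<in> fst c"
  shows "metric_in M c (snd c p) u v = metric M p (to_tangent M c p u) (to_tangent M c p v)"
  using assms by (simp add: metric_in_def)

text \<open>
  In the chart that serves to identify the tangent space at \<open>p\<close> with the model space, the coordinate
  metric at \<open>p\<close> is the metric itself.
\<close>

lemma metric_in_chart_at:
  assumes "p \<in> points M"
  shows "metric_in M (chart_at M p) (coord_at M p) = metric M p"
  using chart_at[OF assms]
  by (simp add: fun_eq_iff coord_at_def metric_in_chart to_tangent_def dderiv_chart_inv)

lemma linear_to_tangent:
  assumes "c \<in> atlas M" "p \<in> fst c" shows "linear (to_tangent M c p)"
  unfolding to_tangent_def using chart_at[OF chart_points[OF assms]] assms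
  by (intro linear_frechet_derivative transition_differentiable)

text \<open>
  The transition map in the opposite direction is a left inverse.
\<close>

lemma inj_to_tangent:
  assumes c: "c \<in> atlas M" "p \<in> fst c" and 0: "to_tangent M c p u = 0" shows "u = 0"
proof -
  note d = chart_at[OF chart_points[OF c]]
  have diff: "(snd c \<circ> chart_inv (chart_at M p)) differentiable (at (snd (chart_at M p) p))"
    by (rule transition_differentiable) (use c d in auto)
  have "u = dderiv (snd c \<circ> chart_inv c) u (snd c p)"
    by (simp add: dderiv_chart_inv c)
  also have "\<dots> = dderiv (snd c \<circ> chart_inv (chart_at M p)) (to_tangent M c p u) (snd (chart_at M p) p)"
    unfolding to_tangent_def by (rule change_of_chart[OF c d diff])
  also have "\<dots> = 0"
    using 0 linear_0[OF linear_frechet_derivative[OF diff]] by simp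
  finally show ?thesis .
qed

lemma local_metric_chart:
  assumes c: "c \<in> atlas M" shows "local_metric (metric_in M c) (chart_image c)"
proof
  show "open (chart_image c)" using chart[OF c] by (simp add: is_chart_def)
  show "smooth_on (\<lambda>x. metric_in M c x u v) (chart_image c)" for u v
    using riem c by (simp add: riemannian_manifold_def)
  fix x assume "x \<in> chart_image c"
  then obtain p where p: "x = snd c p" "p \<in> fst c" by (auto simp: chart_image_def)
  note B = metric_inner[OF chart_points[OF c p(2)]] and T = linear_to_tangent[OF c p(2)]
  have "linear (metric_in M c x u)" for u
    unfolding p(1) metric_in_chart[OF c p(2)]
    using linear_compose[OF T, of "metric M p (to_tangent M c p u)"] B
    unfolding is_inner_product_def o_def by blast
  moreover have "metric_in M c x u v = metric_in M c x v u" for u v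
    unfolding p(1) metric_in_chart[OF c p(2)] using B by (simp add: is_inner_product_def)
  moreover have "metric_in M c x u u > 0" if "u \<noteq> 0" for u
    unfolding p(1) metric_in_chart[OF c p(2)] using B inj_to_tangent[OF c p(2), of u] that
    unfolding is_inner_product_def by blast
  ultimately show "is_inner_product (metric_in M c x)"
    unfolding is_inner_product_def by blast
qed

end

locale immersion = M: manifold M + N: manifold N
  for M :: "('m, 'e::euclidean_space) riem_space" and N :: "('k, 'f::euclidean_space) riem_space" +
  fixes f :: "'m \<Rightarrow> 'k"
  assumes immersion: "isometric_immersion M N f"
begin

lemma continuous: "continuous_map (top_of M) (top_of N) f"
  using immersion by (simp add: isometric_immersion_def smooth_map_def)

lemma f_points: "p \<in> points M \<Longrightarrow> f p \<in> points N"
  using continuous by (auto simp: points_def continuous_map_def)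

lemma smooth_rep:
  assumes "c \<in> atlas M" "d \<in> atlas N"
  shows "smooth_on (snd d \<circ> f \<circ> chart_inv c) (snd c ` (fst c \<inter> f -` fst d))"
  using immersion assms by (simp add: isometric_immersion_def smooth_map_def)

lemma open_rep:
  assumes c: "c \<in> atlas M" and d: "d \<in> atlas N"
  shows "open (snd c ` (fst c \<inter> f -` fst d))"
proof (rule chart_image_open[OF M.chart[OF c]])
  have "openin (top_of M) {p \<in> topspace (top_of M). f p \<in> fst d}"
    using continuous N.chart[OF d] by (intro openin_continuous_map_preimage) (auto simp: is_chart_def)
  moreover have "openin (top_of M) (fst c)"
    using M.chart[OF c] by (simp add: is_chart_def)
  ultimately have "openin (top_of M) (fst c \<inter> {p \<in> topspace (top_of M). f p \<in> fst d})"
    by blast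
  moreover have "fst c \<inter> {p \<in> topspace (top_of M). f p \<in> fst d} = fst c \<inter> f -` fst d"
    using M.chart_points[OF c] by (auto simp: points_def)
  ultimately show "openin (top_of M) (fst c \<inter> f -` fst d)" by simp
qed auto

lemma rep_differentiable:
  assumes "c \<in> atlas M" "d \<in> atlas N" "p \<in> fst c" "f p \<in> fst d"
  shows "(snd d \<circ> f \<circ> chart_inv c) differentiable (at (snd c p))"
  by (rule smooth_on_differentiable[OF smooth_rep]) (use assms in auto)

text \<open>
  Being isometric is defined by the charts selected at \<open>p\<close> and \<open>f p\<close>. It transfers to arbitrary
  charts because both sides reduce, by the chain rule, to the derivative of \<open>f\<close> from the chart \<open>c\<close>
  to the chart selected at \<open>f p\<close>. This makes the coordinate expression of \<open>f\<close> isometric near a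
  point and not only at the point, as needed for differentiating the metric.
\<close>

lemma isometric_in_charts:
  assumes c: "c \<in> atlas M" "p \<in> fst c" and d: "d \<in> atlas N" "f p \<in> fst d"
  defines "F \<equiv> snd d \<circ> f \<circ> chart_inv c"
  shows "metric_in M c (snd c p) u v =
    metric_in N d (F (snd c p)) (dderiv F u (snd c p)) (dderiv F v (snd c p))"
proof -
  have p: "p \<in> points M" by (rule M.chart_points[OF c])
  note cp = M.chart_at[OF p] and dp = N.chart_at[OF f_points[OF p]]
  let ?c = "chart_at M p" and ?d = "chart_at N (f p)"
  have F: "F (snd c p) = snd d (f p)" using c by (simp add: F_def)
  have eq: "differential M N f p (to_tangent M c p u) = to_tangent N d (f p) (dderiv F u (snd c p))" for u
  proof -
    have "differential M N f p (to_tangent M c p u) = dderiv (snd ?d \<circ> f \<circ> chart_inv c) u (snd c p)"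
      unfolding differential_def local_rep_def to_tangent_def coord_at_def
      by (rule M.change_of_chart[OF c cp, symmetric]) (rule rep_differentiable[OF cp(1) dp(1) cp(2) dp(2)])
    also have "\<dots> = dderiv (\<lambda>x. (snd ?d \<circ> chart_inv d) (F x)) u (snd c p)"
      by (rule dderiv_cong[OF open_rep[OF c(1) d(1)]])
        (use c d M.inv_chart[OF c(1)] N.inv_chart[OF d(1)] in \<open>auto simp: F_def\<close>)
    also have "\<dots> = dderiv (snd ?d \<circ> chart_inv d) (dderiv F u (snd c p)) (snd d (f p))"
    proof -
      have 1: "(F has_derivative (\<lambda>u. dderiv F u (snd c p))) (at (snd c p))"
        unfolding F_def by (rule differentiable_has_dderiv[OF rep_differentiable[OF c(1) d(1) c(2) d(2)]])
      have 2: "((snd ?d \<circ> chart_inv d) has_derivative (\<lambda>u. dderiv (snd ?d \<circ> chart_inv d) u (snd d (f p))))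
          (at (F (snd c p)))"
        unfolding F by (rule differentiable_has_dderiv[OF N.transition_differentiable[OF d(1) dp(1) d(2) dp(2)]])
      show ?thesis by (rule dderiv_eqI[OF has_derivative_compose[OF 1 2]])
    qed
    finally show ?thesis by (simp add: to_tangent_def)
  qed
  have "metric_in M c (snd c p) u v = metric N (f p)
      (differential M N f p (to_tangent M c p u)) (differential M N f p (to_tangent M c p v))"
    using immersion p unfolding isometric_immersion_def M.metric_in_chart[OF c] by blast
  then show ?thesis unfolding eq F N.metric_in_chart[OF d] .
qed

end

section \<open>The Gauss equation for a hypersurface of a space of constant curvature\<close>

lemma (in metric_map) linear_hess:
  assumes x: "x \<in> W" shows "linear (\<lambda>u. hess u v x)"
proof -
  have "linear (\<lambda>u. dderiv (dderiv F v) u x)"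
    by (rule has_derivative_linear[OF has_ddF[OF x]])
  moreover have "linear (\<lambda>u. christoffel G (F x) (dderiv F u x) (dderiv F v x))"
    using linear_compose[OF linear_dF[OF x], of "\<lambda>a. christoffel G (F x) a (dderiv F v x)"]
      christoffel_bilinear[OF maps[OF x]] unfolding bilinear_def o_def by blast
  ultimately show ?thesis
    unfolding hess_def cov_def by (rule linear_compose_add)
qed

text \<open>
  The image of \<open>D\<close> and \<open>\<xi>\<close> together span the whole space. A vector orthogonal to the image of \<open>D\<close>,
  with its component along \<open>\<xi>\<close> removed, is orthogonal to this span.
\<close>

lemma normal_space_one_dimensional:
  fixes B :: "'f::euclidean_space \<Rightarrow> 'f \<Rightarrow> real" and D :: "'e::euclidean_space \<Rightarrow> 'f"
  assumes B: "is_inner_product B" and D: "linear D" "inj D"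
    and dim: "DIM('f) = DIM('e) + 1"
    and \<xi>: "B \<xi> \<xi> = 1" "\<And>u. B \<xi> (D u) = 0"
    and n: "\<And>u. B n (D u) = 0"
  shows "n = B n \<xi> *\<^sub>R \<xi>"
proof -
  note bil = inner_product_bilinear[OF B]
  have lin: "linear (B v)" for v using B by (simp add: is_inner_product_def)
  have "span (range D) = range D"
    using D by (simp add: linear_subspace_image span_eq_iff)
  then have "\<xi> \<notin> span (range D)"
    using \<xi> by (metis imageE zero_neq_one)
  then have "dim (insert \<xi> (range D)) = DIM('f)"
    using D dim by (simp add: dim_insert dim_image_eq)
  then have full: "span (insert \<xi> (range D)) = UNIV"
    using dim_eq_full by blast
  define m where "m = n - B n \<xi> *\<^sub>R \<xi>"
  have "B m v = 0" if "v \<in> span (insert \<xi> (range D))" for v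
  proof (rule linear_eq_0_on_span[OF lin _ that])
    show "B m a = 0" if "a \<in> insert \<xi> (range D)" for a
      using that \<xi> n by (auto simp: m_def bilinear_lsub[OF bil] bilinear_lmul[OF bil])
  qed
  then have "B m m = 0" using full by blast
  then have "m = 0" using B by (metis is_inner_product_def less_irrefl)
  then show ?thesis by (simp add: m_def)
qed

text \<open>
  The Gauss equation is applied to the representation of \<open>f\<close> in the charts selected at \<open>p\<close> and \<open>f p\<close>.
  The codimension is one, so that the normal vectors in it are the multiples \<open>H u v *\<^sub>R \<xi> p\<close>, and
  the ambient curvature has the form for constant sectional curvature.
\<close>

lemma (in immersion) hypersurface_at_point:
  assumes p: "p \<in> points M" and dim: "DIM('f) = DIM('e) + 1"
    and cc: "constant_curvature N c" and un: "unit_normal M N f \<xi>"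
  shows second_form_bilinear: "bilinear (second_form M N f \<xi> p)"
    and second_form_sym: "second_form M N f \<xi> p u v = second_form M N f \<xi> p v u"
    and gauss_constant_curvature: "metric M p (curvature M p u v w) z =
      c * (metric M p v w * metric M p u z - metric M p u w * metric M p v z)
      + second_form M N f \<xi> p v w * second_form M N f \<xi> p u z
      - second_form M N f \<xi> p u w * second_form M N f \<xi> p v z"
proof -
  let ?c = "chart_at M p" and ?d = "chart_at N (f p)"
  note cp = M.chart_at[OF p] and fp = f_points[OF p]
  note dp = N.chart_at[OF fp]
  define F where "F = local_rep M N f p"
  define x where "x = coord_at M p"
  define W where "W = snd ?c ` (fst ?c \<inter> f -` fst ?d)"
  define g where "g = metric_in M ?c"
  define G where "G = metric_in N ?d"
  define H where "H = second_form M N f \<xi> p"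
  have F': "F = snd ?d \<circ> f \<circ> chart_inv ?c" by (simp add: F_def local_rep_def)
  have x: "x \<in> W" using cp dp by (simp add: x_def W_def coord_at_def)
  have Fx: "F x = coord_at N (f p)" using cp by (simp add: F' x_def coord_at_def)
  have W: "open W" unfolding W_def by (rule open_rep[OF cp(1) dp(1)])
  interpret metric_map G "chart_image ?d" F W
  proof (rule metric_map.intro[OF _ metric_map_axioms.intro])
    show "local_metric G (chart_image ?d)" unfolding G_def by (rule N.local_metric_chart[OF dp(1)])
    show "smooth_on F W" unfolding F' W_def by (rule smooth_rep[OF cp(1) dp(1)])
    show "F y \<in> chart_image ?d" if "y \<in> W" for y
      using that cp by (auto simp: F' W_def chart_image_def)
  qed (rule W)
  have g: "local_metric g W"
    unfolding g_def by (rule local_metric_subset[OF M.local_metric_chart[OF cp(1)] W])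
      (auto simp: W_def chart_image_def)
  have iso: "g y u v = pullback y u v" if y: "y \<in> W" for y u v
  proof -
    obtain q where q: "y = snd ?c q" "q \<in> fst ?c" "f q \<in> fst ?d"
      using y by (auto simp: W_def)
    show ?thesis
      unfolding q(1) pullback_def unfolding g_def G_def F' by (rule isometric_in_charts[OF cp(1) q(2) dp(1) q(3)])
  qed
  have gx: "g x = metric M p" unfolding g_def x_def by (rule M.metric_in_chart_at[OF p])
  have Gx: "G (F x) = metric N (f p)" unfolding G_def Fx by (rule N.metric_in_chart_at[OF fp])
  have D: "dderiv F u x = differential M N f p u" for u
    by (simp add: differential_def F_def x_def)
  have H: "H u v = G (F x) (hess u v x) (\<xi> p)" for u v
    by (simp add: H_def second_form_def ambient_deriv_def Let_def hess_def cov_def D Gx)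
      (simp add: F_def x_def G_def Fx[unfolded F_def x_def])
  have Hsym: "H u v = H v u" for u v
    by (simp add: H hess_sym[OF x])
  have "linear (\<lambda>u. H u v)" for v
    using linear_compose[OF linear_hess[OF x] linear1[OF maps[OF x]]] by (simp add: H o_def)
  then show "bilinear (second_form M N f \<xi> p)"
    unfolding H_def[symmetric] bilinear_def using Hsym by simp
  show "second_form M N f \<xi> p u v = second_form M N f \<xi> p v u"
    using Hsym by (simp add: H_def)
  have \<xi>: "G (F x) (\<xi> p) (\<xi> p) = 1" "G (F x) (\<xi> p) (dderiv F u x) = 0" for u
    using un p by (simp_all add: unit_normal_def Gx D)
  have inj: "inj (\<lambda>u. dderiv F u x)"
    using immersion p by (simp add: D isometric_immersion_def)
  have II: "II g u v x = H u v *\<^sub>R \<xi> p" for u v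
  proof -
    have "II g u v x = G (F x) (II g u v x) (\<xi> p) *\<^sub>R \<xi> p"
      by (rule normal_space_one_dimensional[OF inner[OF maps[OF x]] linear_dF[OF x] inj dim \<xi>
            II_normal[OF g iso x]])
    moreover have "G (F x) (II g u v x) (\<xi> p) = H u v"
      using \<xi>(2) sym[OF maps[OF x]] by (simp add: II_def H G_simps[OF maps[OF x]])
    ultimately show ?thesis by simp
  qed
  have sec: "G (F x) (curvature_in G (F x) a b b) a / (G (F x) a a * G (F x) b b - (G (F x) a b)\<^sup>2) = c"
    if "a \<noteq> b" "independent {a, b}" for a b
    using cc fp that unfolding constant_curvature_def sectional_curvature_def curvature_def
    by (simp add: Gx) (simp add: G_def Fx)
  have "g x (curvature_in g x u v w) z =
      G (F x) (curvature_in G (F x) (dderiv F u x) (dderiv F v x) (dderiv F w x)) (dderiv F z x)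
      + G (F x) (II g v w x) (II g u z x) - G (F x) (II g u w x) (II g v z x)"
    by (rule gauss_equation[OF g iso x])
  also have "\<dots> = c * (g x v w * g x u z - g x u w * g x v z) + H v w * H u z - H u w * H v z"
    by (simp add: constant_sectional_curvature[OF maps[OF x] sec] iso[OF x] pullback_def II
        G_simps[OF maps[OF x]] \<xi>(1))
  finally show "metric M p (curvature M p u v w) z =
      c * (metric M p v w * metric M p u z - metric M p u w * metric M p v z)
      + second_form M N f \<xi> p v w * second_form M N f \<xi> p u z
      - second_form M N f \<xi> p u w * second_form M N f \<xi> p v z"
    by (simp add: gx H_def curvature_def) (simp add: g_def x_def)
qed

section \<open>The Ricci operator\<close>

lemma op_of_form_eqI:
  assumes B: "is_inner_product B" and z: "\<And>w. B z w = T v w"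
  shows "op_of_form B T v = z"
  unfolding op_of_form_def using z by (intro the_equality) (auto intro: inner_product_eqI[OF B])

lemma op_of_form:
  assumes B: "is_inner_product B" and T: "bilinear T"
  shows "B (op_of_form B T v) w = T v w"
  using the_riesz[OF B] T by (simp add: op_of_form_def bilinear_def)

lemma linear_op_of_form:
  assumes B: "is_inner_product B" and T: "bilinear T"
  shows "linear (op_of_form B T)"
  using inner_product_bilinear[OF B] T
  by (intro linearI inner_product_eqI[OF B])
    (simp_all add: op_of_form[OF B T] bilinear_ladd bilinear_lmul)

lemma lin_trace_add: "lin_trace (\<lambda>u. L u + K u) = lin_trace L + lin_trace K"
  by (simp add: lin_trace_def inner_add_left sum.distrib)

lemma lin_trace_diff: "lin_trace (\<lambda>u. L u - K u) = lin_trace L - lin_trace K"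
  by (simp add: lin_trace_def inner_diff_left sum_subtractf)

lemma lin_trace_scale: "lin_trace (\<lambda>u. a *\<^sub>R L u) = a * lin_trace L"
  by (simp add: lin_trace_def sum_distrib_left)

lemma lin_trace_id: "lin_trace (\<lambda>u::'e::euclidean_space. u) = DIM('e)"
  by (simp add: lin_trace_def)

text \<open>
  Expand \<open>v\<close> in the standard basis. With this formula the Ricci contraction can be carried out in the
  standard basis, although the curvature is expressed by another scalar product.
\<close>

lemma lin_trace_rank_one:
  fixes v :: "'e::euclidean_space"
  assumes "linear k" shows "lin_trace (\<lambda>u. k u *\<^sub>R v) = k v"
proof -
  have "k v = k (\<Sum>b\<in>Basis. (v \<bullet> b) *\<^sub>R b)"
    by (simp add: euclidean_representation)
  also have "\<dots> = (\<Sum>b\<in>Basis. (v \<bullet> b) * k b)"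
    by (simp only: linear_sum[OF assms] linear_scale[OF assms] real_scaleR_def)
  finally show ?thesis by (simp add: lin_trace_def mult.commute)
qed

text \<open>
  As a function of \<open>u\<close>, the vector \<open>R u v w\<close> is a combination of the identity, of \<open>A\<close> and of two operators
  of rank one.
\<close>

lemma ricci_of_gauss:
  fixes B H :: "'e::euclidean_space \<Rightarrow> 'e \<Rightarrow> real"
  assumes B: "is_inner_product B" and H: "bilinear H" "\<And>u v. H u v = H v u"
    and R: "\<And>u v w z. B (R u v w) z = c * (B v w * B u z - B u w * B v z) + H v w * H u z - H u w * H v z"
  defines "A \<equiv> op_of_form B H"
  shows "op_of_form B (\<lambda>v w. lin_trace (\<lambda>u. R u v w)) v =
    ((real DIM('e) - 1) * c) *\<^sub>R v + lin_trace A *\<^sub>R A v - A (A v)"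
proof (rule op_of_form_eqI[OF B])
  note bil = inner_product_bilinear[OF B]
  note bil_simps = bilinear_ladd[OF bil] bilinear_lsub[OF bil] bilinear_lmul[OF bil]
  have A: "B (A u) v = H u v" for u v
    unfolding A_def by (rule op_of_form[OF B H(1)])
  fix w
  have lin: "linear (\<lambda>u. B u w)" "linear (\<lambda>u. H u w)"
    using bil H(1) by (simp_all add: bilinear_def)
  have "R u v w = c *\<^sub>R (B v w *\<^sub>R u - B u w *\<^sub>R v) + (H v w *\<^sub>R A u - H u w *\<^sub>R A v)" for u
    by (rule inner_product_eqI[OF B]) (simp add: R A bil_simps algebra_simps)
  then have "lin_trace (\<lambda>u. R u v w) =
      c * (B v w * DIM('e) - B v w) + (H v w * lin_trace A - H (A v) w)"
    by (simp add: lin_trace_add lin_trace_diff lin_trace_scale lin_trace_id lin_trace_rank_one[OF lin(1)]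
        lin_trace_rank_one[OF lin(2)])
  then show "B (((real DIM('e) - 1) * c) *\<^sub>R v + lin_trace A *\<^sub>R A v - A (A v)) w = lin_trace (\<lambda>u. R u v w)"
    by (simp add: A bil_simps algebra_simps)
qed

section \<open>Operators with three eigenspaces\<close>

lemma three_eigenspaces_independent:
  fixes L :: "'a::real_vector \<Rightarrow> 'a"
  assumes L: "linear L" and v: "L v0 = a0 *\<^sub>R v0" "L v1 = a1 *\<^sub>R v1" "L v2 = a2 *\<^sub>R v2"
    and ne: "a0 \<noteq> a1" "a0 \<noteq> a2" "a1 \<noteq> a2" and sum: "v0 + v1 + v2 = 0"
  shows "v0 = 0 \<and> v1 = 0 \<and> v2 = 0"
proof -
  have *: "w0 = 0" if w: "L w0 = b0 *\<^sub>R w0" "L w1 = b1 *\<^sub>R w1" "L w2 = b2 *\<^sub>R w2"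
    and b: "b0 \<noteq> b1" "b0 \<noteq> b2" and s: "w0 + w1 + w2 = 0" for w0 w1 w2 b0 b1 b2
  proof -
    have 1: "b0 *\<^sub>R w0 + b1 *\<^sub>R w1 + b2 *\<^sub>R w2 = 0"
      using arg_cong[OF s, of L] w by (simp add: linear_add[OF L] linear_0[OF L])
    then have "L (b0 *\<^sub>R w0 + b1 *\<^sub>R w1 + b2 *\<^sub>R w2) = 0"
      using linear_0[OF L] by simp
    then have 2: "b0 *\<^sub>R b0 *\<^sub>R w0 + b1 *\<^sub>R b1 *\<^sub>R w1 + b2 *\<^sub>R b2 *\<^sub>R w2 = 0"
      by (simp add: linear_add[OF L] linear_scale[OF L] w)
    \<comment> \<open>the polynomial \<open>(X - b1) (X - b2)\<close> in \<open>L\<close> kills \<open>w1\<close> and \<open>w2\<close>\<close>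
    have "((b0 - b1) * (b0 - b2)) *\<^sub>R w0 =
        (b0 *\<^sub>R b0 *\<^sub>R w0 + b1 *\<^sub>R b1 *\<^sub>R w1 + b2 *\<^sub>R b2 *\<^sub>R w2)
        - (b1 + b2) *\<^sub>R (b0 *\<^sub>R w0 + b1 *\<^sub>R w1 + b2 *\<^sub>R w2) + (b1 * b2) *\<^sub>R (w0 + w1 + w2)"
      by (simp add: algebra_simps)
    also have "\<dots> = 0" by (simp only: 1 2 s) simp
    finally show ?thesis using b by simp
  qed
  have "v0 = 0" using *[OF v ne(1,2) sum] .
  moreover have "v1 = 0" using *[OF v(2,1,3)] ne sum by (simp add: add.commute)
  moreover have "v2 = 0" using *[OF v(3,1,2)] ne sum by (simp add: ac_simps)
  ultimately show ?thesis by simp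
qed

lemma subspace_eigenspace: "linear L \<Longrightarrow> subspace (eigenspace L a)"
  by (auto simp: subspace_def eigenspace_def linear_0 linear_add linear_scale scaleR_add_right)

text \<open>
  Eigenspaces to distinct eigenvalues form a direct sum, whose dimension is here that of the space.
\<close>

lemma three_eigenspaces_span:
  fixes L :: "'e::euclidean_space \<Rightarrow> 'e"
  assumes L: "linear L" and ne: "a0 \<noteq> a1" "a0 \<noteq> a2" "a1 \<noteq> a2"
    and dim: "dim (eigenspace L a0) + dim (eigenspace L a1) + dim (eigenspace L a2) = DIM('e)"
  shows "\<exists>v0 v1 v2. v = v0 + v1 + v2 \<and> L v0 = a0 *\<^sub>R v0 \<and> L v1 = a1 *\<^sub>R v1 \<and> L v2 = a2 *\<^sub>R v2"
proof -
  let ?E = "eigenspace L"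
  note sub = subspace_eigenspace[OF L]
  let ?S = "{x + y |x y. x \<in> ?E a0 \<and> y \<in> ?E a1}"
  have S: "subspace ?S" by (rule subspace_sums[OF sub sub])
  have "?E a0 \<inter> ?E a1 = {0}"
    using three_eigenspaces_independent[OF L, of _ a0 "- _" a1 0 a2] ne linear_0[OF L]
    by (auto simp: eigenspace_def linear_neg[OF L])
  then have d1: "dim ?S = dim (?E a0) + dim (?E a1)"
    using dim_sums_Int[OF sub sub, of a0 a1] by simp
  have "?S \<inter> ?E a2 = {0}"
  proof -
    have "x + y = 0" if "L x = a0 *\<^sub>R x" "L y = a1 *\<^sub>R y" "L (x + y) = a2 *\<^sub>R (x + y)" for x y
      using three_eigenspaces_independent[OF L that(1,2), of "- (x + y)" a2] that ne
      by (simp add: linear_neg[OF L] del: minus_add_distrib)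
    then have "\<forall>z \<in> ?S \<inter> ?E a2. z = 0" by (auto simp: eigenspace_def)
    then show ?thesis using subspace_0[OF S] subspace_0[OF sub, of a2] by blast
  qed
  then have "dim {x + y |x y. x \<in> ?S \<and> y \<in> ?E a2} = DIM('e)"
    using dim_sums_Int[OF S sub, of a2] d1 dim by simp
  then have "span {x + y |x y. x \<in> ?S \<and> y \<in> ?E a2} = UNIV"
    by (simp only: dim_eq_full)
  then have "{x + y |x y. x \<in> ?S \<and> y \<in> ?E a2} = UNIV"
    by (simp only: span_eq_iff[THEN iffD2, OF subspace_sums[OF S sub]])
  then have "v \<in> {x + y |x y. x \<in> ?S \<and> y \<in> ?E a2}" by blast
  then show ?thesis by (auto simp: eigenspace_def)
qed

text \<open>
  With \<open>s = a0 + a1 + a2 - t\<close>, each factor \<open>t - ai - aj\<close> equals \<open>ak - s\<close>, and the left-hand side is the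
  value at \<open>s\<close> of the polynomial \<open>(a0 - X) (a1 - X) (a2 - X)\<close>.
\<close>

lemma ricci_eigenvalue_difference_product:
  fixes t :: real
  assumes ne: "a0 \<noteq> a1" "a0 \<noteq> a2" "a1 \<noteq> a2"
    and k: "k0 = t * a0 - a0\<^sup>2 + b" "k1 = t * a1 - a1\<^sup>2 + b" "k2 = t * a2 - a2\<^sup>2 + b"
  shows "a0 * a1 * a2 + ((a0 + a1 + a2) - t) * ((- a0 * (a1 + a2) - a1 * a2) + t * ((a0 + a1 + a2) - t)) =
    ((k0 - k1) * (k0 - k2) * (k1 - k2)) / ((a0 - a1) * (a0 - a2) * (a1 - a2))"
proof -
  have d: "k0 - k1 = (a0 - a1) * (t - a0 - a1)" "k0 - k2 = (a0 - a2) * (t - a0 - a2)"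
    "k1 - k2 = (a1 - a2) * (t - a1 - a2)"
    by (simp_all add: k power2_eq_square algebra_simps)
  have *: "((k0 - k1) * (k0 - k2) * (k1 - k2)) / ((a0 - a1) * (a0 - a2) * (a1 - a2))
      = (t - a0 - a1) * (t - a0 - a2) * (t - a1 - a2)"
    unfolding d using ne by simp
  show ?thesis unfolding * by (simp add: algebra_simps)
qed

section \<open>Ricci eigenvalues of a hypersurface with three principal curvatures\<close>

theorem theorem5p2:
  fixes M :: "('m, 'e::euclidean_space) riem_space"
    and N :: "('k, 'f::euclidean_space) riem_space"
    and f :: "'m \<Rightarrow> 'k" and \<xi> :: "'m \<Rightarrow> 'f" and c :: real
    and \<mu>0 \<mu>1 \<mu>2 \<kappa>0 \<kappa>1 \<kappa>2 \<phi> \<psi> \<rho> \<tau> :: "'m \<Rightarrow> real"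
    and n0 n1 n2 :: "'m \<Rightarrow> nat"
  assumes "riemannian_manifold M" and "riemannian_manifold N"
    and "DIM('e) \<ge> 3" and "DIM('f) = DIM('e) + 1"
    and "constant_curvature N c"
    and "isometric_immersion M N f" and "unit_normal M N f \<xi>"
    and principal_curvatures: "\<And>p. p \<in> U_H M N f \<xi> \<Longrightarrow>
      eigenvalues (shape_op M N f \<xi> p) = {\<mu>0 p, \<mu>1 p, \<mu>2 p} \<and>
      \<mu>0 p \<noteq> \<mu>1 p \<and> \<mu>0 p \<noteq> \<mu>2 p \<and> \<mu>1 p \<noteq> \<mu>2 p"
    and multiplicities: "\<And>p. p \<in> U_H M N f \<xi> \<Longrightarrow>
      dim (eigenspace (shape_op M N f \<xi> p) (\<mu>0 p)) = n0 p \<and>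
      dim (eigenspace (shape_op M N f \<xi> p) (\<mu>1 p)) = n1 p \<and>
      dim (eigenspace (shape_op M N f \<xi> p) (\<mu>2 p)) = n2 p \<and>
      n0 p + n1 p + n2 p = DIM('e)"
    and kappa: "\<And>p. p \<in> U_H M N f \<xi> \<Longrightarrow>
      \<kappa>0 p = trH M N f \<xi> p * \<mu>0 p - (\<mu>0 p)\<^sup>2 + (real DIM('e) - 1) * c \<and>
      \<kappa>1 p = trH M N f \<xi> p * \<mu>1 p - (\<mu>1 p)\<^sup>2 + (real DIM('e) - 1) * c \<and>
      \<kappa>2 p = trH M N f \<xi> p * \<mu>2 p - (\<mu>2 p)\<^sup>2 + (real DIM('e) - 1) * c"
    and phi: "\<And>p. p \<in> U_H M N f \<xi> \<Longrightarrow> \<phi> p = \<mu>0 p + \<mu>1 p + \<mu>2 p"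
    and psi: "\<And>p. p \<in> U_H M N f \<xi> \<Longrightarrow> \<psi> p = - \<mu>0 p * (\<mu>1 p + \<mu>2 p) - \<mu>1 p * \<mu>2 p"
    and rho: "\<And>p. p \<in> U_H M N f \<xi> \<Longrightarrow> \<rho> p = \<mu>0 p * \<mu>1 p * \<mu>2 p"
    and tau: "\<And>p. p \<in> U_H M N f \<xi> \<Longrightarrow>
      \<tau> p = \<rho> p + (\<phi> p - trH M N f \<xi> p) *
                     (\<psi> p + trH M N f \<xi> p * (\<phi> p - trH M N f \<xi> p))"
  shows "\<forall>p \<in> U_H M N f \<xi>.
    eigenvalues (ricci_op M p) = {\<kappa>0 p, \<kappa>1 p, \<kappa>2 p} \<and>
    eigenspace (shape_op M N f \<xi> p) (\<mu>0 p) \<subseteq> eigenspace (ricci_op M p) (\<kappa>0 p) \<and>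
    eigenspace (shape_op M N f \<xi> p) (\<mu>1 p) \<subseteq> eigenspace (ricci_op M p) (\<kappa>1 p) \<and>
    eigenspace (shape_op M N f \<xi> p) (\<mu>2 p) \<subseteq> eigenspace (ricci_op M p) (\<kappa>2 p) \<and>
    (\<forall>u v. second_form3 M N f \<xi> p u v =
       \<phi> p * second_form2 M N f \<xi> p u v + \<psi> p * second_form M N f \<xi> p u v
         + \<rho> p * metric M p u v) \<and>
    \<tau> p = ((\<kappa>0 p - \<kappa>1 p) * (\<kappa>0 p - \<kappa>2 p) * (\<kappa>1 p - \<kappa>2 p)) /
          ((\<mu>0 p - \<mu>1 p) * (\<mu>0 p - \<mu>2 p) * (\<mu>1 p - \<mu>2 p))"
proof
  fix p assume pU: "p \<in> U_H M N f \<xi>"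
  then have p: "p \<in> points M" by (simp add: U_H_def)
  interpret immersion M N f by unfold_locales (use assms in auto)
  define A where "A = shape_op M N f \<xi> p"
  define L where "L = ricci_op M p"
  define t where "t = trH M N f \<xi> p"
  define b where "b = (real DIM('e) - 1) * c"
  note B = M.metric_inner[OF p]
  note H = second_form_bilinear[OF p assms(4,5,7)]
  have A_eq: "A = op_of_form (metric M p) (second_form M N f \<xi> p)"
    by (simp add: A_def shape_op_def)
  have AH: "metric M p (A u) v = second_form M N f \<xi> p u v" for u v
    unfolding A_eq by (rule op_of_form[OF B H])
  have linA: "linear A" unfolding A_eq by (rule linear_op_of_form[OF B H])
  have ric: "L v = b *\<^sub>R v + t *\<^sub>R A v - A (A v)" for v
    unfolding L_def ricci_op_def ricci_def[abs_def] b_def t_def trH_def A_def shape_op_def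
    by (rule ricci_of_gauss[OF B H second_form_sym[OF p assms(4,5,7)]
          gauss_constant_curvature[OF p assms(4,5,7)]])
  note ev = principal_curvatures[OF pU, folded A_def]
  note ne = ev[THEN conjunct2]
  note k = kappa[OF pU, folded t_def b_def]
  \<comment> \<open>the Ricci operator is a polynomial in \<open>A\<close>\<close>
  have ricE: "A v = a *\<^sub>R v \<Longrightarrow> L v = (t * a - a\<^sup>2 + b) *\<^sub>R v" for a v
    by (simp add: ric linear_scale[OF linA] algebra_simps power2_eq_square)
  have split: "\<exists>v0 v1 v2. v = v0 + v1 + v2 \<and> A v0 = \<mu>0 p *\<^sub>R v0 \<and> A v1 = \<mu>1 p *\<^sub>R v1 \<and> A v2 = \<mu>2 p *\<^sub>R v2" for v
    using multiplicities[OF pU, folded A_def] ne by (intro three_eigenspaces_span[OF linA]) auto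
  have E: "A v = \<mu>0 p *\<^sub>R v \<Longrightarrow> L v = \<kappa>0 p *\<^sub>R v" "A v = \<mu>1 p *\<^sub>R v \<Longrightarrow> L v = \<kappa>1 p *\<^sub>R v"
    "A v = \<mu>2 p *\<^sub>R v \<Longrightarrow> L v = \<kappa>2 p *\<^sub>R v" for v
    using ricE k by auto
  have "\<mu>0 p \<in> eigenvalues A" "\<mu>1 p \<in> eigenvalues A" "\<mu>2 p \<in> eigenvalues A"
    using ev by auto
  then have "{\<kappa>0 p, \<kappa>1 p, \<kappa>2 p} \<subseteq> eigenvalues L"
    using E unfolding eigenvalues_def by blast
  moreover have "a \<in> {\<kappa>0 p, \<kappa>1 p, \<kappa>2 p}" if "a \<in> eigenvalues L" for a
  proof (rule ccontr)
    assume a: "a \<notin> {\<kappa>0 p, \<kappa>1 p, \<kappa>2 p}"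
    obtain v where v: "v \<noteq> 0" "L v = a *\<^sub>R v" using \<open>a \<in> eigenvalues L\<close> by (auto simp: eigenvalues_def)
    obtain v0 v1 v2 where v': "v = v0 + v1 + v2"
      and A': "A v0 = \<mu>0 p *\<^sub>R v0" "A v1 = \<mu>1 p *\<^sub>R v1" "A v2 = \<mu>2 p *\<^sub>R v2"
      using split by blast
    have "L v = L v0 + L v1 + L v2"
      by (simp add: v' ric linear_add[OF linA] algebra_simps)
    then have "(\<kappa>0 p - a) *\<^sub>R v0 + (\<kappa>1 p - a) *\<^sub>R v1 + (\<kappa>2 p - a) *\<^sub>R v2 = 0"
      using v(2) E(1)[OF A'(1)] E(2)[OF A'(2)] E(3)[OF A'(3)] by (simp add: v' algebra_simps)
    \<comment> \<open>the summands \<open>(\<kappa>i - a) vi\<close> lie in different eigenspaces of \<open>A\<close>\<close>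
    from three_eigenspaces_independent[OF linA _ _ _ _ _ _ this, of "\<mu>0 p" "\<mu>1 p" "\<mu>2 p"]
    have "v0 = 0 \<and> v1 = 0 \<and> v2 = 0"
      using a ne by (auto simp: linear_scale[OF linA] A')
    then show False using v v' by simp
  qed
  ultimately have "eigenvalues L = {\<kappa>0 p, \<kappa>1 p, \<kappa>2 p}" by blast
  moreover have "A (A (A v)) = \<phi> p *\<^sub>R A (A v) + \<psi> p *\<^sub>R A v + \<rho> p *\<^sub>R v" for v
  proof -
    have *: "A (A (A w)) = \<phi> p *\<^sub>R A (A w) + \<psi> p *\<^sub>R A w + \<rho> p *\<^sub>R w"
      if "A w = a *\<^sub>R w" "a \<in> {\<mu>0 p, \<mu>1 p, \<mu>2 p}" for w a
    proof -
      \<comment> \<open>\<open>a\<close> is a root of the polynomial with roots \<open>\<mu>0\<close>, \<open>\<mu>1\<close>, \<open>\<mu>2\<close>\<close>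
      have "a * (a * a) = \<phi> p * (a * a) + \<psi> p * a + \<rho> p"
        using that(2) by (auto simp: phi[OF pU] psi[OF pU] rho[OF pU] algebra_simps)
      then show ?thesis
        by (simp add: that(1) linear_scale[OF linA] flip: scaleR_add_left)
    qed
    obtain v0 v1 v2 where v': "v = v0 + v1 + v2"
      and A': "A v0 = \<mu>0 p *\<^sub>R v0" "A v1 = \<mu>1 p *\<^sub>R v1" "A v2 = \<mu>2 p *\<^sub>R v2"
      using split by blast
    show ?thesis
      using *[OF A'(1)] *[OF A'(2)] *[OF A'(3)]
      by (simp add: v' linear_add[OF linA] scaleR_add_right)
  qed
  then have "second_form3 M N f \<xi> p u v =
      \<phi> p * second_form2 M N f \<xi> p u v + \<psi> p * second_form M N f \<xi> p u v + \<rho> p * metric M p u v" for u v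
    using inner_product_bilinear[OF B]
    by (simp add: second_form3_def second_form2_def bilinear_ladd bilinear_lmul flip: A_def AH)
  moreover have "\<tau> p = ((\<kappa>0 p - \<kappa>1 p) * (\<kappa>0 p - \<kappa>2 p) * (\<kappa>1 p - \<kappa>2 p)) /
      ((\<mu>0 p - \<mu>1 p) * (\<mu>0 p - \<mu>2 p) * (\<mu>1 p - \<mu>2 p))"
    unfolding tau[OF pU] phi[OF pU] psi[OF pU] rho[OF pU] t_def[symmetric]
    by (rule ricci_eigenvalue_difference_product) (use ne k in auto)
  ultimately show "eigenvalues (ricci_op M p) = {\<kappa>0 p, \<kappa>1 p, \<kappa>2 p} \<and>
    eigenspace (shape_op M N f \<xi> p) (\<mu>0 p) \<subseteq> eigenspace (ricci_op M p) (\<kappa>0 p) \<and>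
    eigenspace (shape_op M N f \<xi> p) (\<mu>1 p) \<subseteq> eigenspace (ricci_op M p) (\<kappa>1 p) \<and>
    eigenspace (shape_op M N f \<xi> p) (\<mu>2 p) \<subseteq> eigenspace (ricci_op M p) (\<kappa>2 p) \<and>
    (\<forall>u v. second_form3 M N f \<xi> p u v =
       \<phi> p * second_form2 M N f \<xi> p u v + \<psi> p * second_form M N f \<xi> p u v
         + \<rho> p * metric M p u v) \<and>
    \<tau> p = ((\<kappa>0 p - \<kappa>1 p) * (\<kappa>0 p - \<kappa>2 p) * (\<kappa>1 p - \<kappa>2 p)) /
          ((\<mu>0 p - \<mu>1 p) * (\<mu>0 p - \<mu>2 p) * (\<mu>1 p - \<mu>2 p))"
    using E unfolding A_def[symmetric] L_def[symmetric] by (auto simp: eigenspace_def)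
qed

end
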